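(* Let $\mathcal{C}$ be a locally Krull--Schmidt category with a full collection of pairwise non-isomorphic indecomposable objects $\{X_i\}_{i\in I}$ (every indecomposable object of $\mathcal{C}$ is isomorphic to exactly one $X_i$). If $\mathcal{C}$ admits locally finite direct sums of indecomposable objects, then its split Grothendieck group is a free $\mathbb{Z}$-module $$K_0^{\oplus}(\mathcal{C})\;\cong\;\prod_{i\in I}\mathbb{Z}\cdot[X_i],$$ with basis $\{[X_i]\}_{i\in I}$. Moreover, $[M]=\sum_{i\in I}X_i^*(M)\,[X_i]$ for all $M\in\mathcal{C}$.
   Context: Categories are (essentially) small. The symbol $\bigoplus$ denotes a possibly infinite biproduct: in a category with zero morphisms, a coproduct $\coprod_i Y_i$ with injections $\imath_k$ has canonical projections $p_j:\coprod_i Y_i\to Y_j$ (with $p_j\circ\imath_k=\delta_{jk}$), and it is a biproduct if the induced natural transformation $\operatorname{Hom}(-,\coprod_i Y_i)\to\prod_i\operatorname{Hom}(-,Y_i)$ is an isomorphism. A locally finite direct sum of a collection $\{X_i\}_{i\in I}$ is a biproduct $\bigoplus_{i\in I}X_i^{\oplus n_i}$ with all $n_i\in\mathbb{N}$; $n_i$ is called the multiplicity of $X_i$. The category admits locally finite direct sums of indecomposables if $\bigoplus_{i\in I}X_i^{\oplus n_i}$ exists in $\mathcal{C}$ for every family $(n_i)_{i\in I}$ in $\mathbb{N}$. An object $X$ is compact if for every family $\{N_i\}$ whose coproduct exists, the natural map $\coprod_i\operatorname{Hom}(X,N_i)\to\operatorname{Hom}(X,\coprod_i N_i)$ is an isomorphism.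 An additive category is locally Krull--Schmidt if every object decomposes as a locally finite direct sum of pairwise non-isomorphic compact objects having local endomorphism rings; such a decomposition into indecomposables is essentially unique, and $X^*(M)\in\mathbb{N}$ denotes the multiplicity of the indecomposable object $X$ in $M$. The split Grothendieck group $K_0^\oplus(\mathcal{C})$ is the free abelian group on isomorphism classes of objects modulo $[Y]=[X]+[Z]$ whenever $Y\cong X\oplus Z$.
   Formalization: For infinite I the product of copies of Z is not free and the [X_i] do not span it; "free with basis" and the sum for [M] are read as unique, possibly infinite, coordinatewise convergent Z-linear sums of the [X_i], every coefficient family occurring; for finite I this is ordinary freeness. *)

theory Defs
  imports "HOL-Algebra.Free_Abelian_Groups" "HOL-Algebra.Ring"
begin

section \<open>Small preadditive categories\<close>

record ('o, 'm) precat =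
  Obj :: "'o set"
  Arr :: "'m set"
  Dom :: "'m \<Rightarrow> 'o"
  Cod :: "'m \<Rightarrow> 'o"
  Ident :: "'o \<Rightarrow> 'm"
  Comp :: "'m \<Rightarrow> 'm \<Rightarrow> 'm"  (infixr \<open>\<cdot>\<index>\<close> 75)
  Plus :: "'m \<Rightarrow> 'm \<Rightarrow> 'm"
  ZeroArr :: "'o \<Rightarrow> 'o \<Rightarrow> 'm"

definition Hom :: "('o, 'm) precat \<Rightarrow> 'o \<Rightarrow> 'o \<Rightarrow> 'm set" where
  "Hom C A B = {f \<in> Arr C. Dom C f = A \<and> Cod C f = B}"

definition hom_group :: "('o, 'm) precat \<Rightarrow> 'o \<Rightarrow> 'o \<Rightarrow> 'm monoid" where
  "hom_group C A B = \<lparr>carrier = Hom C A B, monoid.mult = Plus C, one = ZeroArr C A B\<rparr>"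

definition end_ring :: "('o, 'm) precat \<Rightarrow> 'o \<Rightarrow> 'm ring" where
  "end_ring C A = \<lparr>carrier = Hom C A A, monoid.mult = Comp C, one = Ident C A,
                   ring.zero = ZeroArr C A A, ring.add = Plus C\<rparr>"

locale category =
  fixes C :: "('o, 'm) precat" (structure)
  assumes Dom_closed: "f \<in> Arr C \<Longrightarrow> Dom C f \<in> Obj C"
    and Cod_closed: "f \<in> Arr C \<Longrightarrow> Cod C f \<in> Obj C"
    and Ident_closed: "A \<in> Obj C \<Longrightarrow> Ident C A \<in> Hom C A A"
    and Comp_closed: "f \<in> Hom C A B \<Longrightarrow> g \<in> Hom C B D \<Longrightarrow> g \<cdot> f \<in> Hom C A D"
    and Comp_Ident: "f \<in> Hom C A B \<Longrightarrow> f \<cdot> Ident C A = f"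
    and Ident_Comp: "f \<in> Hom C A B \<Longrightarrow> Ident C B \<cdot> f = f"
    and Comp_assoc: "f \<in> Hom C A B \<Longrightarrow> g \<in> Hom C B D \<Longrightarrow> h \<in> Hom C D E
                       \<Longrightarrow> (h \<cdot> g) \<cdot> f = h \<cdot> (g \<cdot> f)"

locale preadditive_category = category C for C :: "('o, 'm) precat" (structure) +
  assumes hom_comm_group: "A \<in> Obj C \<Longrightarrow> B \<in> Obj C \<Longrightarrow> comm_group (hom_group C A B)"
    and Comp_Plus: "f \<in> Hom C A B \<Longrightarrow> f' \<in> Hom C A B \<Longrightarrow> g \<in> Hom C B D
                      \<Longrightarrow> g \<cdot> Plus C f f' = Plus C (g \<cdot> f) (g \<cdot> f')"
    and Plus_Comp: "f \<in> Hom C A B \<Longrightarrow> g \<in> Hom C B D \<Longrightarrow> g' \<in> Hom C B D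
                      \<Longrightarrow> Plus C g g' \<cdot> f = Plus C (g \<cdot> f) (g' \<cdot> f)"

definition isomorphic :: "('o, 'm) precat \<Rightarrow> 'o \<Rightarrow> 'o \<Rightarrow> bool" where
  "isomorphic C A B \<longleftrightarrow> A \<in> Obj C \<and> B \<in> Obj C \<and>
     (\<exists>f \<in> Hom C A B. \<exists>g \<in> Hom C B A.
        g \<cdot>\<^bsub>C\<^esub> f = Ident C A \<and> f \<cdot>\<^bsub>C\<^esub> g = Ident C B)"

definition zero_object :: "('o, 'm) precat \<Rightarrow> 'o \<Rightarrow> bool" where
  "zero_object C A \<longleftrightarrow> A \<in> Obj C \<and>
     (\<forall>B \<in> Obj C. (\<exists>!f. f \<in> Hom C A B) \<and> (\<exists>!f. f \<in> Hom C B A))"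


section \<open>Coproducts and biproducts\<close>

definition is_coproduct ::
  "('o, 'm) precat \<Rightarrow> 'j set \<Rightarrow> ('j \<Rightarrow> 'o) \<Rightarrow> 'o \<Rightarrow> ('j \<Rightarrow> 'm) \<Rightarrow> bool" where
  "is_coproduct C J Y P \<iota> \<longleftrightarrow>
     P \<in> Obj C \<and> (\<forall>j\<in>J. Y j \<in> Obj C \<and> \<iota> j \<in> Hom C (Y j) P) \<and>
     (\<forall>Z \<in> Obj C. \<forall>g. (\<forall>j\<in>J. g j \<in> Hom C (Y j) Z) \<longrightarrow>
        (\<exists>!h. h \<in> Hom C P Z \<and> (\<forall>j\<in>J. h \<cdot>\<^bsub>C\<^esub> \<iota> j = g j)))"

definition canonical_proj ::
  "('o, 'm) precat \<Rightarrow> 'j set \<Rightarrow> ('j \<Rightarrow> 'o) \<Rightarrow> 'o \<Rightarrow> ('j \<Rightarrow> 'm) \<Rightarrow> 'j \<Rightarrow> 'm" where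
  "canonical_proj C J Y P \<iota> j =
     (THE p. p \<in> Hom C P (Y j) \<and>
        (\<forall>k\<in>J. p \<cdot>\<^bsub>C\<^esub> \<iota> k = (if k = j then Ident C (Y j) else ZeroArr C (Y k) (Y j))))"

definition is_biproduct ::
  "('o, 'm) precat \<Rightarrow> 'j set \<Rightarrow> ('j \<Rightarrow> 'o) \<Rightarrow> 'o \<Rightarrow> ('j \<Rightarrow> 'm) \<Rightarrow> bool" where
  "is_biproduct C J Y P \<iota> \<longleftrightarrow> is_coproduct C J Y P \<iota> \<and>
     (\<forall>Z \<in> Obj C. bij_betw (\<lambda>h. \<lambda>j\<in>J. canonical_proj C J Y P \<iota> j \<cdot>\<^bsub>C\<^esub> h)
                     (Hom C Z P) (\<Pi>\<^sub>E j\<in>J. Hom C Z (Y j)))"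

text \<open>\<open>direct_sum C A B Y\<close> says that \<open>Y\<close> is isomorphic to the direct sum of \<open>A\<close> and \<open>B\<close>;
  carrying a biproduct structure is invariant under isomorphism of the apex. The same applies
  to \<open>lf_direct_sum\<close> below.\<close>

definition direct_sum :: "('o, 'm) precat \<Rightarrow> 'o \<Rightarrow> 'o \<Rightarrow> 'o \<Rightarrow> bool" where
  "direct_sum C A B Y \<longleftrightarrow> (\<exists>\<iota>. is_biproduct C {..<2} ((!) [A, B]) Y \<iota>)"

text \<open>The empty list provides the zero object.\<close>

locale additive_category = preadditive_category C for C :: "('o, 'm) precat" (structure) +
  assumes finite_biproducts:
    "set Ys \<subseteq> Obj C \<Longrightarrow> \<exists>P \<iota>. is_biproduct C {..<length Ys} ((!) Ys) P \<iota>"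

text \<open>The object \<open>M\<close> is a biproduct of \<open>n i\<close> copies of \<open>X i\<close>, for \<open>i\<close> ranging over \<open>I\<close>.\<close>

definition lf_direct_sum ::
  "('o, 'm) precat \<Rightarrow> 'i set \<Rightarrow> ('i \<Rightarrow> 'o) \<Rightarrow> ('i \<Rightarrow> nat) \<Rightarrow> 'o \<Rightarrow> bool" where
  "lf_direct_sum C I X n M \<longleftrightarrow>
     (\<exists>\<iota>. is_biproduct C (SIGMA i:I. {..<n i}) (\<lambda>(i, k). X i) M \<iota>)"

definition admits_lf_direct_sums ::
  "('o, 'm) precat \<Rightarrow> 'i set \<Rightarrow> ('i \<Rightarrow> 'o) \<Rightarrow> bool" where
  "admits_lf_direct_sums C I X \<longleftrightarrow> (\<forall>n. \<exists>M. lf_direct_sum C I X n M)"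


section \<open>Locally Krull--Schmidt categories\<close>

text \<open>Families are indexed by sets of arrows. This is no restriction: if a family \<open>N\<close> has a
  coproduct, then zero members may be dropped without affecting the coproduct or the comparison
  map, and the injections of the nonzero members are pairwise distinct arrows, so that the family
  can be reindexed by them.\<close>

definition compact_object :: "('o, 'm) precat \<Rightarrow> 'o \<Rightarrow> bool" where
  "compact_object C X \<longleftrightarrow> X \<in> Obj C \<and>
     (\<forall>(J :: 'm set) N P \<iota>. is_coproduct C J N P \<iota> \<longrightarrow>
        (\<lambda>x. gfinprod (hom_group C X P) (\<lambda>j. \<iota> j \<cdot>\<^bsub>C\<^esub> x j) J)
          \<in> iso (sum_group J (\<lambda>j. hom_group C X (N j))) (hom_group C X P))"

definition local_ring :: "('a, 'b) ring_scheme \<Rightarrow> bool" where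
  "local_ring R \<longleftrightarrow> ring R \<and> \<one>\<^bsub>R\<^esub> \<noteq> \<zero>\<^bsub>R\<^esub> \<and>
     (\<forall>a \<in> carrier R - Units R. \<forall>b \<in> carrier R - Units R. a \<oplus>\<^bsub>R\<^esub> b \<notin> Units R)"

definition indecomposable :: "('o, 'm) precat \<Rightarrow> 'o \<Rightarrow> bool" where
  "indecomposable C X \<longleftrightarrow> X \<in> Obj C \<and> \<not> zero_object C X \<and>
     (\<forall>A B. direct_sum C A B X \<longrightarrow> zero_object C A \<or> zero_object C B)"

text \<open>Since the summands are pairwise non-isomorphic, they are indexed by a set of objects.\<close>

definition ks_decomposition ::
  "('o, 'm) precat \<Rightarrow> 'o \<Rightarrow> 'o set \<Rightarrow> ('o \<Rightarrow> nat) \<Rightarrow> bool" where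
  "ks_decomposition C M S n \<longleftrightarrow>
     (\<forall>Y\<in>S. compact_object C Y \<and> local_ring (end_ring C Y)) \<and>
     (\<forall>Y\<in>S. \<forall>Z\<in>S. isomorphic C Y Z \<longrightarrow> Y = Z) \<and>
     lf_direct_sum C S (\<lambda>Y. Y) n M"

locale locally_krull_schmidt = additive_category C for C :: "('o, 'm) precat" (structure) +
  assumes ks_decomposition_exists: "M \<in> Obj C \<Longrightarrow> \<exists>S n. ks_decomposition C M S n"

text \<open>The multiplicity of \<open>X\<close> in \<open>M\<close>, read off from any decomposition of \<open>M\<close>; the sum has at most
  one term.\<close>

definition multiplicity_in :: "('o, 'm) precat \<Rightarrow> 'o \<Rightarrow> 'o \<Rightarrow> nat" where
  "multiplicity_in C X M =
     (THE m. \<exists>S n. ks_decomposition C M S n \<and> m = (\<Sum>Y | Y \<in> S \<and> isomorphic C Y X. n Y))"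

definition full_indecomposables :: "('o, 'm) precat \<Rightarrow> 'i set \<Rightarrow> ('i \<Rightarrow> 'o) \<Rightarrow> bool" where
  "full_indecomposables C I X \<longleftrightarrow>
     (\<forall>i\<in>I. indecomposable C (X i)) \<and>
     (\<forall>i\<in>I. \<forall>j\<in>I. isomorphic C (X i) (X j) \<longrightarrow> i = j) \<and>
     (\<forall>Y. indecomposable C Y \<longrightarrow> (\<exists>!i. i \<in> I \<and> isomorphic C Y (X i)))"


section \<open>The split Grothendieck group\<close>

definition iso_rel :: "('o, 'm) precat \<Rightarrow> ('o \<times> 'o) set" where
  "iso_rel C = {(A, B). isomorphic C A B}"

abbreviation iso_free_group :: "('o, 'm) precat \<Rightarrow> ('o set \<Rightarrow>\<^sub>0 int) monoid" where
  "iso_free_group C \<equiv> free_Abelian_group (Obj C // iso_rel C)"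

definition obj_gen :: "('o, 'm) precat \<Rightarrow> 'o \<Rightarrow> ('o set \<Rightarrow>\<^sub>0 int)" where
  "obj_gen C A = frag_of (iso_rel C `` {A})"

definition split_relations :: "('o, 'm) precat \<Rightarrow> ('o set \<Rightarrow>\<^sub>0 int) set" where
  "split_relations C = generate (iso_free_group C)
     {obj_gen C Y - (obj_gen C X + obj_gen C Z) | X Y Z. direct_sum C X Z Y}"

definition K0_split :: "('o, 'm) precat \<Rightarrow> ('o set \<Rightarrow>\<^sub>0 int) set monoid" where
  "K0_split C = iso_free_group C Mod split_relations C"

definition K0_class :: "('o, 'm) precat \<Rightarrow> 'o \<Rightarrow> ('o set \<Rightarrow>\<^sub>0 int) set" where
  "K0_class C A = split_relations C #>\<^bsub>iso_free_group C\<^esub> obj_gen C A"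


section \<open>Infinite sums in a product of copies of the integers\<close>

text \<open>For an identification \<open>\<Phi>\<close> of an abelian group \<open>K\<close> with the product of copies of the integers
  indexed by \<open>I\<close>, the element \<open>x\<close> is the sum of the family \<open>f\<close> over \<open>I\<close>: the net of finite partial
  sums converges to \<open>x\<close> in the product of the discrete topologies, i.e. every coordinate is
  eventually constant. For finite \<open>I\<close> this is the ordinary sum. If \<open>I\<close> is infinite, the product is
  not a free abelian group in the usual sense, and a basis of it is a family in terms of which
  every element is uniquely such a sum. Groups are written multiplicatively, so partial sums
  appear as \<open>finprod\<close>.\<close>

definition has_coord_sum ::
  "('k, 'b) monoid_scheme \<Rightarrow> ('k \<Rightarrow> 'i \<Rightarrow> int) \<Rightarrow> 'i set \<Rightarrow> ('i \<Rightarrow> 'k) \<Rightarrow> 'k \<Rightarrow> bool" where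
  "has_coord_sum K \<Phi> I f x \<longleftrightarrow>
     (\<forall>j\<in>I. eventually (\<lambda>F. \<Phi> (finprod K f F) j = \<Phi> x j) (finite_subsets_at_top I))"

text \<open>The coefficient families are \<open>undefined\<close> off \<open>I\<close>, as elements of \<open>product_group\<close> are. Every
  coefficient family defines an element, and every element has a unique coefficient family.\<close>

definition product_basis ::
  "('k, 'b) monoid_scheme \<Rightarrow> ('k \<Rightarrow> 'i \<Rightarrow> int) \<Rightarrow> 'i set \<Rightarrow> ('i \<Rightarrow> 'k) \<Rightarrow> bool" where
  "product_basis K \<Phi> I b \<longleftrightarrow>
     (\<forall>i\<in>I. b i \<in> carrier K) \<and>
     (\<forall>a \<in> I \<rightarrow>\<^sub>E UNIV. \<exists>x \<in> carrier K. has_coord_sum K \<Phi> I (\<lambda>i. b i [^]\<^bsub>K\<^esub> (a i :: int)) x) \<and>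
     (\<forall>x \<in> carrier K. \<exists>!a. a \<in> I \<rightarrow>\<^sub>E UNIV \<and> has_coord_sum K \<Phi> I (\<lambda>i. b i [^]\<^bsub>K\<^esub> (a i :: int)) x)"

end

theory Submission
  imports Defs
begin

text \<open>
  Sending an object \<open>M\<close> to the family of its multiplicities \<open>(X\<^sub>i\<^sup>*(M))\<^sub>i\<close> identifies the monoid of
  isomorphism classes of objects, with \<open>\<oplus>\<close> as addition, with \<open>\<nat>\<^sup>I\<close>: objects with the same
  multiplicities are coproducts of the same family and hence isomorphic (\<open>isomorphic_iff_mult\<close>),
  every family is realised because locally finite direct sums exist (\<open>mult_realised\<close>), and
  multiplicities add up along direct sums (\<open>mult_direct_sum\<close>). The split Grothendieck group is the
  group completion of this monoid, that is, \<open>\<int>\<^sup>I\<close>. It is the full product and not only the direct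
  sum, since the positive and the negative part of any family of integers are multiplicities of
  objects (\<open>K0_iso\<close>).

  The substance of the proof is that multiplicities are well defined. Suppose that \<open>m\<close> copies of a
  compact object \<open>X\<close> are a retract of a coproduct of objects \<open>Y\<^sub>j\<close>, all with local endomorphism
  rings. By compactness the identity of \<open>X\<^sup>m\<close> is a matrix product through finitely many of the
  \<open>Y\<^sub>j\<close>. Whenever a composite \<open>X \<rightarrow> Y\<^sub>j \<rightarrow> X\<close> is invertible, both factors are isomorphisms
  (\<open>iso_factors_if_local\<close>), so Gaussian elimination removes one row and one object \<open>Y\<^sub>j \<cong> X\<close> at a
  time, and \<open>m\<close> is at most the number of such \<open>j\<close> (\<open>local_matrix_rank\<close>,
  \<open>retract_multiplicity_le\<close>). Applied to two decompositions of the same object, in both directions,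
  this gives \<open>lf_coproduct_unique\<close>.

  That result concerns objects which are compact with local endomorphism ring, whereas the \<open>X\<^sub>i\<close> are
  only known to be indecomposable. The gap is closed by \<open>X_compact_local\<close>: the complement of a
  summand in a decomposition of \<open>X\<^sub>i\<close> is again a locally finite direct sum of indecomposables, so it
  is an object of the category and has to vanish.

  Finally, a family of multiples \<open>a\<^sub>i [X\<^sub>i]\<close> sums up to \<open>x\<close> exactly if \<open>a\<close> is the family of
  coordinates of \<open>x\<close>, because the \<open>[X\<^sub>i]\<close> have the unit vectors as coordinates
  (\<open>has_coord_sum_unit_vectors\<close>).
\<close>

section \<open>Arrows in a preadditive category\<close>

definition is_iso :: "('o, 'm) precat \<Rightarrow> 'o \<Rightarrow> 'o \<Rightarrow> 'm \<Rightarrow> bool" where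
  "is_iso C A B f \<longleftrightarrow> f \<in> Hom C A B \<and>
     (\<exists>g \<in> Hom C B A. g \<cdot>\<^bsub>C\<^esub> f = Ident C A \<and> f \<cdot>\<^bsub>C\<^esub> g = Ident C B)"

lemma isomorphic_iff: "isomorphic C A B \<longleftrightarrow> A \<in> Obj C \<and> B \<in> Obj C \<and> (\<exists>f. is_iso C A B f)"
  by (auto simp: isomorphic_def is_iso_def)

context category
begin

lemma Hom_objs: "f \<in> Hom C A B \<Longrightarrow> A \<in> Obj C \<and> B \<in> Obj C"
  using Dom_closed Cod_closed by (auto simp: Hom_def)

text \<open>In terms of \<open>Dom\<close> and \<open>Cod\<close>, the category axioms become conditional rewrite rules whose
  side conditions the simplifier can solve; in \<open>Comp_assoc\<close> it would have to guess the objects,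
  which do not occur in the conclusion.\<close>

lemma Comp_arr:
  assumes "f \<in> Arr C" "g \<in> Arr C" "Dom C g = Cod C f"
  shows "g \<cdot> f \<in> Arr C" "Dom C (g \<cdot> f) = Dom C f" "Cod C (g \<cdot> f) = Cod C g"
  using Comp_closed[of f "Dom C f" "Cod C f" g "Cod C g"] assms by (auto simp: Hom_def)

lemma Comp_assoc_arr:
  assumes "f \<in> Arr C" "g \<in> Arr C" "h \<in> Arr C" "Dom C g = Cod C f" "Dom C h = Cod C g"
  shows "(h \<cdot> g) \<cdot> f = h \<cdot> (g \<cdot> f)"
  using Comp_assoc[of f "Dom C f" "Cod C f" g "Cod C g" h "Cod C h"] assms by (auto simp: Hom_def)

lemma Ident_arr:
  assumes "A \<in> Obj C"
  shows "Ident C A \<in> Arr C" "Dom C (Ident C A) = A" "Cod C (Ident C A) = A"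
  using Ident_closed[OF assms] by (auto simp: Hom_def)

lemma Comp_Ident_arr: "f \<in> Arr C \<Longrightarrow> A = Dom C f \<Longrightarrow> f \<cdot> Ident C A = f"
  using Comp_Ident[of f "Dom C f" "Cod C f"] by (auto simp: Hom_def)

lemma Ident_Comp_arr: "f \<in> Arr C \<Longrightarrow> A = Cod C f \<Longrightarrow> Ident C A \<cdot> f = f"
  using Ident_Comp[of f "Dom C f" "Cod C f"] by (auto simp: Hom_def)

lemmas arr_simps = Comp_arr Comp_assoc_arr Ident_arr Comp_Ident_arr Ident_Comp_arr
  Dom_closed Cod_closed

lemma is_iso_inverse:
  assumes "is_iso C A B f"
  obtains g where "is_iso C B A g" "g \<cdot> f = Ident C A" "f \<cdot> g = Ident C B"
  using assms unfolding is_iso_def by blast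

lemma is_isoI:
  "\<lbrakk>f \<in> Hom C A B; g \<in> Hom C B A; g \<cdot> f = Ident C A; f \<cdot> g = Ident C B\<rbrakk> \<Longrightarrow> is_iso C A B f"
  unfolding is_iso_def by blast

lemma is_iso_Hom: "is_iso C A B f \<Longrightarrow> f \<in> Hom C A B"
  unfolding is_iso_def by blast

lemma is_iso_Ident: "A \<in> Obj C \<Longrightarrow> is_iso C A A (Ident C A)"
  by (rule is_isoI[of _ _ _ "Ident C A"]) (auto intro: Ident_closed Comp_Ident Ident_Comp)

lemma is_iso_Comp:
  assumes "is_iso C A B f" "is_iso C B D g"
  shows "is_iso C A D (g \<cdot> f)"
proof -
  obtain f' where f': "f' \<in> Hom C B A" "f' \<cdot> f = Ident C A" "f \<cdot> f' = Ident C B"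
    using assms(1) unfolding is_iso_def by blast
  obtain g' where g': "g' \<in> Hom C D B" "g' \<cdot> g = Ident C B" "g \<cdot> g' = Ident C D"
    using assms(2) unfolding is_iso_def by blast
  have fg: "f \<in> Hom C A B" "g \<in> Hom C B D"
    using assms is_iso_Hom by auto
  show ?thesis
  proof (rule is_isoI)
    have "(f' \<cdot> g') \<cdot> (g \<cdot> f) = f' \<cdot> ((g' \<cdot> g) \<cdot> f)"
      using fg f'(1) g'(1) by (simp add: Hom_def arr_simps)
    then show "(f' \<cdot> g') \<cdot> (g \<cdot> f) = Ident C A"
      using fg f' g' Ident_Comp by simp
    have "(g \<cdot> f) \<cdot> (f' \<cdot> g') = g \<cdot> ((f \<cdot> f') \<cdot> g')"
      using fg f'(1) g'(1) by (simp add: Hom_def arr_simps)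
    then show "(g \<cdot> f) \<cdot> (f' \<cdot> g') = Ident C D"
      using fg f' g' Ident_Comp by simp
  qed (use fg f' g' Comp_closed in auto)
qed

lemma isomorphic_refl: "A \<in> Obj C \<Longrightarrow> isomorphic C A A"
  using is_iso_Ident isomorphic_iff by metis

lemma isomorphic_sym: "isomorphic C A B \<Longrightarrow> isomorphic C B A"
  using is_iso_inverse isomorphic_iff by metis

lemma isomorphic_trans: "isomorphic C A B \<Longrightarrow> isomorphic C B D \<Longrightarrow> isomorphic C A D"
  using is_iso_Comp isomorphic_iff by metis

end

context preadditive_category
begin

abbreviation neg :: "'o \<Rightarrow> 'o \<Rightarrow> 'm \<Rightarrow> 'm" where
  "neg A B f \<equiv> inv\<^bsub>hom_group C A B\<^esub> f"

abbreviation arr_sum :: "'o \<Rightarrow> 'o \<Rightarrow> ('j \<Rightarrow> 'm) \<Rightarrow> 'j set \<Rightarrow> 'm" where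
  "arr_sum A B f F \<equiv> finprod (hom_group C A B) f F"

lemma hom_group_sel [simp]:
  "carrier (hom_group C A B) = Hom C A B"
  "monoid.mult (hom_group C A B) = Plus C"
  "one (hom_group C A B) = ZeroArr C A B"
  by (auto simp: hom_group_def)

lemma Zero_closed: "A \<in> Obj C \<Longrightarrow> B \<in> Obj C \<Longrightarrow> ZeroArr C A B \<in> Hom C A B"
  using hom_comm_group[of A B] comm_group.axioms(2) group.is_monoid monoid.one_closed
  by (metis hom_group_sel(1,3))

lemma Plus_closed: "f \<in> Hom C A B \<Longrightarrow> g \<in> Hom C A B \<Longrightarrow> Plus C f g \<in> Hom C A B"
  using hom_comm_group[of A B] comm_group.axioms(2) group.is_monoid monoid.m_closed Hom_objs
  by (metis hom_group_sel(1,2))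

lemma neg_closed: "f \<in> Hom C A B \<Longrightarrow> neg A B f \<in> Hom C A B"
  using hom_comm_group[of A B] comm_group.axioms(2) group.inv_closed Hom_objs
  by (metis hom_group_sel(1))

lemma Plus_Zero: "f \<in> Hom C A B \<Longrightarrow> Plus C f (ZeroArr C A B) = f"
  using hom_comm_group[of A B] comm_group.axioms(2) group.is_monoid monoid.r_one Hom_objs
  by (metis hom_group_sel)

lemma Zero_Plus: "f \<in> Hom C A B \<Longrightarrow> Plus C (ZeroArr C A B) f = f"
  using hom_comm_group[of A B] comm_group.axioms(2) group.is_monoid monoid.l_one Hom_objs
  by (metis hom_group_sel)

lemma Plus_neg: "f \<in> Hom C A B \<Longrightarrow> Plus C f (neg A B f) = ZeroArr C A B"
  using hom_comm_group[of A B] comm_group.axioms(2) group.r_inv Hom_objs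
  by (metis hom_group_sel)

lemma Plus_commute: "f \<in> Hom C A B \<Longrightarrow> g \<in> Hom C A B \<Longrightarrow> Plus C f g = Plus C g f"
  using hom_comm_group[of A B] comm_group.axioms(1) comm_monoid.m_comm Hom_objs
  by (metis hom_group_sel(1,2))

lemma Plus_assoc:
  "f \<in> Hom C A B \<Longrightarrow> g \<in> Hom C A B \<Longrightarrow> h \<in> Hom C A B
    \<Longrightarrow> Plus C (Plus C f g) h = Plus C f (Plus C g h)"
  using hom_comm_group[of A B] comm_group.axioms(2) group.is_monoid monoid.m_assoc Hom_objs
  by (metis hom_group_sel(1,2))

lemma neg_unique:
  assumes "f \<in> Hom C A B" "g \<in> Hom C A B" "Plus C f g = ZeroArr C A B"
  shows "neg A B f = g"
proof -
  interpret G: comm_group "hom_group C A B"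
    using hom_comm_group assms(1) Hom_objs by blast
  show ?thesis
    using assms G.inv_equality[of g f] G.m_comm[of f g] by simp
qed

lemma Plus_idem:
  assumes "f \<in> Hom C A B" "Plus C f f = f"
  shows "f = ZeroArr C A B"
proof -
  interpret G: comm_group "hom_group C A B"
    using hom_comm_group assms(1) Hom_objs by blast
  show ?thesis
    using assms G.r_cancel_one[of f f] by simp
qed

lemma Comp_Zero:
  assumes "g \<in> Hom C B D" "A \<in> Obj C"
  shows "g \<cdot> ZeroArr C A B = ZeroArr C A D"
proof (rule Plus_idem)
  have z: "ZeroArr C A B \<in> Hom C A B"
    using assms Hom_objs Zero_closed by blast
  show "g \<cdot> ZeroArr C A B \<in> Hom C A D"
    using z assms Comp_closed by blast
  show "Plus C (g \<cdot> ZeroArr C A B) (g \<cdot> ZeroArr C A B) = g \<cdot> ZeroArr C A B"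
    using Comp_Plus[OF z z assms(1)] Plus_Zero[OF z] by simp
qed

lemma Zero_Comp:
  assumes "f \<in> Hom C A B" "D \<in> Obj C"
  shows "ZeroArr C B D \<cdot> f = ZeroArr C A D"
proof (rule Plus_idem)
  have z: "ZeroArr C B D \<in> Hom C B D"
    using assms Hom_objs Zero_closed by blast
  show "ZeroArr C B D \<cdot> f \<in> Hom C A D"
    using z assms Comp_closed by blast
  show "Plus C (ZeroArr C B D \<cdot> f) (ZeroArr C B D \<cdot> f) = ZeroArr C B D \<cdot> f"
    using Plus_Comp[OF assms(1) z z] Plus_Zero[OF z] by simp
qed

lemma Comp_neg:
  assumes "f \<in> Hom C A B" "g \<in> Hom C B D"
  shows "g \<cdot> neg A B f = neg A D (g \<cdot> f)"
proof (rule neg_unique[symmetric])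
  show "Plus C (g \<cdot> f) (g \<cdot> neg A B f) = ZeroArr C A D"
    using Comp_Plus[OF assms(1) neg_closed[OF assms(1)] assms(2)] Plus_neg[OF assms(1)]
      Comp_Zero[OF assms(2)] Hom_objs[OF assms(1)] by simp
qed (use assms neg_closed Comp_closed in blast)+

lemma neg_Comp:
  assumes "f \<in> Hom C A B" "g \<in> Hom C B D"
  shows "neg B D g \<cdot> f = neg A D (g \<cdot> f)"
proof (rule neg_unique[symmetric])
  show "Plus C (g \<cdot> f) (neg B D g \<cdot> f) = ZeroArr C A D"
    using Plus_Comp[OF assms(1) assms(2) neg_closed[OF assms(2)]] Plus_neg[OF assms(2)]
      Zero_Comp[OF assms(1)] Hom_objs[OF assms(2)] by simp
qed (use assms neg_closed Comp_closed in blast)+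

lemma arr_sum_closed:
  assumes "A \<in> Obj C" "B \<in> Obj C" "\<And>j. j \<in> F \<Longrightarrow> f j \<in> Hom C A B"
  shows "arr_sum A B f F \<in> Hom C A B"
proof -
  interpret G: comm_group "hom_group C A B" using assms hom_comm_group by blast
  show ?thesis using G.finprod_closed[of f F] assms by auto
qed

lemma arr_sum_empty:
  assumes "A \<in> Obj C" "B \<in> Obj C"
  shows "arr_sum A B f {} = ZeroArr C A B"
proof -
  interpret G: comm_group "hom_group C A B" using assms hom_comm_group by blast
  show ?thesis using G.finprod_empty by simp
qed

lemma arr_sum_insert:
  assumes "finite F" "j \<notin> F" "A \<in> Obj C" "B \<in> Obj C" "\<And>i. i \<in> insert j F \<Longrightarrow> f i \<in> Hom C A B"
  shows "arr_sum A B f (insert j F) = Plus C (f j) (arr_sum A B f F)"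
proof -
  interpret G: comm_group "hom_group C A B" using assms hom_comm_group by blast
  show ?thesis using G.finprod_insert[of F j f] assms by auto
qed

lemma arr_sum_cong:
  assumes "A \<in> Obj C" "B \<in> Obj C" "\<And>j. j \<in> F \<Longrightarrow> f j \<in> Hom C A B" "\<And>j. j \<in> F \<Longrightarrow> f j = g j"
  shows "arr_sum A B f F = arr_sum A B g F"
proof -
  interpret G: comm_group "hom_group C A B" using assms hom_comm_group by blast
  show ?thesis by (rule G.finprod_cong') (use assms in auto)
qed

lemma arr_sum_mono_neutral:
  assumes "A \<in> Obj C" "B \<in> Obj C" "finite F" "E \<subseteq> F"
    "\<And>j. j \<in> E \<Longrightarrow> f j \<in> Hom C A B" "\<And>j. j \<in> F - E \<Longrightarrow> f j = ZeroArr C A B"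
  shows "arr_sum A B f E = arr_sum A B f F"
proof -
  interpret G: comm_group "hom_group C A B" using assms hom_comm_group by blast
  have "f j \<in> Hom C A B" if "j \<in> F" for j
    using that assms Zero_closed by (cases "j \<in> E") auto
  then show ?thesis by (intro G.finprod_mono_neutral_cong_left) (use assms in auto)
qed

lemma arr_sum_Plus:
  assumes "A \<in> Obj C" "B \<in> Obj C" "\<And>j. j \<in> F \<Longrightarrow> f j \<in> Hom C A B" "\<And>j. j \<in> F \<Longrightarrow> g j \<in> Hom C A B"
  shows "arr_sum A B (\<lambda>j. Plus C (f j) (g j)) F = Plus C (arr_sum A B f F) (arr_sum A B g F)"
proof -
  interpret G: comm_group "hom_group C A B" using assms hom_comm_group by blast
  show ?thesis using G.finprod_multf[of f F g] assms by auto
qed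

lemma Comp_arr_sum:
  assumes "finite F" "A \<in> Obj C" "\<And>j. j \<in> F \<Longrightarrow> f j \<in> Hom C A B" "h \<in> Hom C B D"
  shows "h \<cdot> arr_sum A B f F = arr_sum A D (\<lambda>j. h \<cdot> f j) F"
  using assms(1,3)
proof (induction F)
  case empty
  then show ?case using Comp_Zero[OF assms(4,2)] assms(2) Hom_objs[OF assms(4)]
    by (simp add: arr_sum_empty)
next
  case (insert j F)
  have o: "B \<in> Obj C" "D \<in> Obj C" using assms Hom_objs by auto
  have "arr_sum A B f (insert j F) = Plus C (f j) (arr_sum A B f F)"
    using insert o assms(2) by (intro arr_sum_insert) auto
  then have "h \<cdot> arr_sum A B f (insert j F) = Plus C (h \<cdot> f j) (h \<cdot> arr_sum A B f F)"
    using insert.prems o assms(2) by (simp add: Comp_Plus[OF _ arr_sum_closed assms(4)])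
  also have "\<dots> = Plus C (h \<cdot> f j) (arr_sum A D (\<lambda>j. h \<cdot> f j) F)"
    using insert by simp
  also have "\<dots> = arr_sum A D (\<lambda>j. h \<cdot> f j) (insert j F)"
    using insert o assms(2) Comp_closed[OF _ assms(4)] by (intro arr_sum_insert[symmetric]) auto
  finally show ?case .
qed

lemma arr_sum_Comp:
  assumes "finite F" "\<And>j. j \<in> F \<Longrightarrow> f j \<in> Hom C B D" "D \<in> Obj C" "h \<in> Hom C A B"
  shows "arr_sum B D f F \<cdot> h = arr_sum A D (\<lambda>j. f j \<cdot> h) F"
  using assms(1,2)
proof (induction F)
  case empty
  then show ?case using Zero_Comp[OF assms(4,3)] assms(3) Hom_objs[OF assms(4)]
    by (simp add: arr_sum_empty)
next
  case (insert j F)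
  have o: "A \<in> Obj C" "B \<in> Obj C" using assms Hom_objs by auto
  have "arr_sum B D f (insert j F) = Plus C (f j) (arr_sum B D f F)"
    using insert o assms(3) by (intro arr_sum_insert) auto
  then have "arr_sum B D f (insert j F) \<cdot> h = Plus C (f j \<cdot> h) (arr_sum B D f F \<cdot> h)"
    using insert.prems o assms(3) by (simp add: Plus_Comp[OF assms(4) _ arr_sum_closed])
  also have "\<dots> = Plus C (f j \<cdot> h) (arr_sum A D (\<lambda>j. f j \<cdot> h) F)"
    using insert by simp
  also have "\<dots> = arr_sum A D (\<lambda>j. f j \<cdot> h) (insert j F)"
    using insert o assms(3) Comp_closed[OF assms(4)] by (intro arr_sum_insert[symmetric]) auto
  finally show ?case .
qed

text \<open>If \<open>1\<^sub>A = 0\<close>, then \<open>f = f 1\<^sub>A = 0\<close> for every arrow \<open>f\<close> out of \<open>A\<close>, and dually.\<close>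

lemma zero_object_iff: "zero_object C A \<longleftrightarrow> A \<in> Obj C \<and> Ident C A = ZeroArr C A A"
proof
  assume "zero_object C A"
  then show "A \<in> Obj C \<and> Ident C A = ZeroArr C A A"
    unfolding zero_object_def using Ident_closed Zero_closed by blast
next
  assume A: "A \<in> Obj C \<and> Ident C A = ZeroArr C A A"
  have "f = ZeroArr C A B" if "f \<in> Hom C A B" for B f
    using that A Comp_Ident[OF that] Comp_Zero[OF that] by simp
  moreover have "f = ZeroArr C B A" if "f \<in> Hom C B A" for B f
    using that A Ident_Comp[OF that] Zero_Comp[OF that] by simp
  ultimately show "zero_object C A"
    unfolding zero_object_def using A Zero_closed by metis
qed

end

section \<open>Objects with local endomorphism rings\<close>

text \<open>A local endomorphism ring in terms of \<open>is_iso\<close>, so that units of \<open>End X\<close> and isomorphisms between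
  different objects are treated alike.\<close>

definition local_object :: "('o, 'm) precat \<Rightarrow> 'o \<Rightarrow> bool" where
  "local_object C X \<longleftrightarrow> X \<in> Obj C \<and> Ident C X \<noteq> ZeroArr C X X \<and>
     (\<forall>f \<in> Hom C X X. \<forall>g \<in> Hom C X X.
        is_iso C X X (Plus C f g) \<longrightarrow> is_iso C X X f \<or> is_iso C X X g)"

lemma end_ring_sel [simp]:
  "carrier (end_ring C A) = Hom C A A"
  "monoid.mult (end_ring C A) = Comp C"
  "one (end_ring C A) = Ident C A"
  "ring.zero (end_ring C A) = ZeroArr C A A"
  "ring.add (end_ring C A) = Plus C"
  by (auto simp: end_ring_def)

lemma Units_end_ring: "f \<in> Units (end_ring C A) \<longleftrightarrow> is_iso C A A f"
  by (auto simp: Units_def is_iso_def)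

lemma local_object_if_local_ring:
  assumes "X \<in> Obj C" "local_ring (end_ring C X)"
  shows "local_object C X"
  using assms unfolding local_object_def local_ring_def
  by (auto simp: Units_end_ring Ball_def)

context preadditive_category
begin

lemma local_object_obj: "local_object C X \<Longrightarrow> X \<in> Obj C"
  by (auto simp: local_object_def)

lemma local_object_Ident: "local_object C X \<Longrightarrow> Ident C X \<noteq> ZeroArr C X X"
  by (auto simp: local_object_def)

lemma local_object_not_zero: "local_object C X \<Longrightarrow> \<not> zero_object C X"
  by (auto simp: local_object_def zero_object_iff)

lemma zero_not_iso:
  assumes "Ident C X \<noteq> ZeroArr C X X" "X \<in> Obj C" "Y \<in> Obj C"
  shows "\<not> is_iso C X Y (ZeroArr C X Y)"
  using assms Comp_Zero unfolding is_iso_def by metis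

text \<open>If \<open>g f\<close> is invertible, then \<open>f (g f)\<inverse> g\<close> is an idempotent endomorphism of \<open>Y\<close>; as
  \<open>End Y\<close> is local, this idempotent is \<open>0\<close> or \<open>1\<close>, and \<open>0\<close> is impossible since \<open>X\<close> is nonzero.\<close>

lemma iso_factors_if_local:
  assumes X: "Ident C X \<noteq> ZeroArr C X X" and Y: "local_object C Y"
    and f: "f \<in> Hom C X Y" and g: "g \<in> Hom C Y X" and gf: "is_iso C X X (g \<cdot> f)"
  shows "is_iso C X Y f" "is_iso C Y X g"
proof -
  obtain v where v: "v \<in> Hom C X X" "v \<cdot> (g \<cdot> f) = Ident C X" "(g \<cdot> f) \<cdot> v = Ident C X"
    using gf unfolding is_iso_def by blast
  have o: "X \<in> Obj C" "Y \<in> Obj C" using f Hom_objs by auto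
  define e where "e = f \<cdot> (v \<cdot> g)"
  have e: "e \<in> Hom C Y Y" unfolding e_def using f g v Comp_closed by blast
  have "e \<cdot> e = f \<cdot> ((v \<cdot> (g \<cdot> f)) \<cdot> (v \<cdot> g))"
    unfolding e_def using f g v(1) by (simp add: Hom_def arr_simps)
  also have "\<dots> = f \<cdot> (Ident C X \<cdot> (v \<cdot> g))" by (simp add: v(2))
  also have "\<dots> = e"
    unfolding e_def using f g v(1) o by (simp add: Hom_def arr_simps)
  finally have ee: "e \<cdot> e = e" .
  define e' where "e' = Plus C (Ident C Y) (neg Y Y e)"
  have e': "e' \<in> Hom C Y Y" unfolding e'_def using e o Ident_closed neg_closed Plus_closed by blast
  have "Plus C e e' = Plus C (Ident C Y) (Plus C e (neg Y Y e))"
    unfolding e'_def using Plus_assoc[OF e Ident_closed[OF o(2)] neg_closed[OF e]]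
      Plus_assoc[OF Ident_closed[OF o(2)] e neg_closed[OF e]]
      Plus_commute[OF e Ident_closed[OF o(2)]] by simp
  then have "Plus C e e' = Ident C Y"
    using Plus_neg[OF e] Plus_Zero Ident_closed[OF o(2)] by simp
  then have "is_iso C Y Y (Plus C e e')" using is_iso_Ident o by simp
  then have "is_iso C Y Y e \<or> is_iso C Y Y e'"
    using Y e e' unfolding local_object_def by blast
  moreover have "\<not> is_iso C Y Y e'"
  proof
    assume "is_iso C Y Y e'"
    then obtain w where w: "w \<in> Hom C Y Y" "e' \<cdot> w = Ident C Y" unfolding is_iso_def by blast
    have "e \<cdot> e' = Plus C (e \<cdot> Ident C Y) (e \<cdot> neg Y Y e)"
      unfolding e'_def using e o by (intro Comp_Plus) (auto intro: Ident_closed neg_closed)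
    also have "\<dots> = Plus C e (neg Y Y e)" using e ee by (simp add: Comp_Ident Comp_neg)
    also have "\<dots> = ZeroArr C Y Y" by (rule Plus_neg[OF e])
    finally have z: "e \<cdot> e' = ZeroArr C Y Y" .
    have "e = (e \<cdot> e') \<cdot> w"
      using e e' w by (simp add: Comp_assoc[OF w(1) e' e] Comp_Ident)
    then have ez: "e = ZeroArr C Y Y" using z Zero_Comp[OF w(1)] o by simp
    have "Ident C X = ((g \<cdot> f) \<cdot> v) \<cdot> ((g \<cdot> f) \<cdot> v)"
      using v Comp_Ident[OF Ident_closed[OF o(1)]] by simp
    also have "\<dots> = g \<cdot> (e \<cdot> (f \<cdot> v))"
      unfolding e_def using f g v(1) by (simp add: Hom_def arr_simps)
    also have "\<dots> = ZeroArr C X X"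
      using ez f g v(1) o by (simp add: Zero_Comp[OF Comp_closed[OF v(1) f]] Comp_Zero[OF g])
    finally show False using X by simp
  qed
  ultimately obtain w where w: "w \<in> Hom C Y Y" "e \<cdot> w = Ident C Y" unfolding is_iso_def by blast
  have "e = e \<cdot> (e \<cdot> w)" using w e Comp_Ident by simp
  also have "\<dots> = (e \<cdot> e) \<cdot> w" using w(1) e Comp_assoc by simp
  also have "\<dots> = Ident C Y" using ee w by simp
  finally have e1: "e = Ident C Y" .
  show "is_iso C X Y f"
  proof (rule is_isoI[OF f])
    show "v \<cdot> g \<in> Hom C Y X" using g v Comp_closed by blast
    show "(v \<cdot> g) \<cdot> f = Ident C X" using v(2) Comp_assoc[OF f g v(1)] by simp
    show "f \<cdot> v \<cdot> g = Ident C Y" using e1 unfolding e_def .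
  qed
  show "is_iso C Y X g"
  proof (rule is_isoI[OF g])
    show "f \<cdot> v \<in> Hom C X Y" using f v Comp_closed by blast
    show "(f \<cdot> v) \<cdot> g = Ident C Y" using e1 Comp_assoc[OF g v(1) f] unfolding e_def by simp
    show "g \<cdot> f \<cdot> v = Ident C X" using v(3) Comp_assoc[OF v(1) f g] by simp
  qed
qed

lemma local_object_isomorphic:
  assumes Y: "local_object C Y" and "isomorphic C X Y"
  shows "local_object C X"
proof -
  obtain u where "is_iso C X Y u" and X: "X \<in> Obj C"
    using assms(2) isomorphic_iff by metis
  then obtain v where u: "is_iso C X Y u" and v: "is_iso C Y X v"
    and vu: "v \<cdot> u = Ident C X" and uv: "u \<cdot> v = Ident C Y"
    using is_iso_inverse by metis
  have uH: "u \<in> Hom C X Y" and vH: "v \<in> Hom C Y X" using u v is_iso_Hom by auto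
  have Yo: "Y \<in> Obj C" using Y local_object_obj by simp
  have conj_iso: "is_iso C X X f" if f: "f \<in> Hom C X X" and i: "is_iso C Y Y (u \<cdot> f \<cdot> v)" for f
  proof -
    have "v \<cdot> (u \<cdot> f \<cdot> v) \<cdot> u = (v \<cdot> u) \<cdot> (f \<cdot> (v \<cdot> u))"
      using uH vH f by (simp add: Hom_def arr_simps)
    then have "v \<cdot> (u \<cdot> f \<cdot> v) \<cdot> u = f"
      using vu f Comp_Ident Ident_Comp by simp
    then show ?thesis using is_iso_Comp[OF is_iso_Comp[OF u i] v] by simp
  qed
  have "is_iso C X X f \<or> is_iso C X X g"
    if f: "f \<in> Hom C X X" and g: "g \<in> Hom C X X" and i: "is_iso C X X (Plus C f g)" for f g
  proof -
    have "is_iso C Y Y (u \<cdot> Plus C f g \<cdot> v)"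
      using is_iso_Comp[OF is_iso_Comp[OF v i] u] by simp
    also have "u \<cdot> Plus C f g \<cdot> v = Plus C (u \<cdot> f \<cdot> v) (u \<cdot> g \<cdot> v)"
      using Plus_Comp[OF vH f g] Comp_Plus[OF Comp_closed[OF vH f] Comp_closed[OF vH g] uH] by simp
    finally have "is_iso C Y Y (u \<cdot> f \<cdot> v) \<or> is_iso C Y Y (u \<cdot> g \<cdot> v)"
      using Y f g uH vH Comp_closed unfolding local_object_def by blast
    then show ?thesis using conj_iso f g by blast
  qed
  moreover have "Ident C X \<noteq> ZeroArr C X X"
  proof
    assume "Ident C X = ZeroArr C X X"
    then have "u = ZeroArr C X Y" using Comp_Ident[OF uH] Comp_Zero[OF uH X] by simp
    then have "Ident C Y = ZeroArr C Y Y" using uv Zero_Comp[OF vH Yo] by simp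
    then show False using Y local_object_Ident by blast
  qed
  ultimately show ?thesis using X unfolding local_object_def by blast
qed

lemma nonunit_Plus:
  assumes "local_object C X" "f \<in> Hom C X X" "g \<in> Hom C X X"
    "\<not> is_iso C X X f" "\<not> is_iso C X X g"
  shows "\<not> is_iso C X X (Plus C f g)"
  using assms unfolding local_object_def by blast

lemma iso_summand:
  assumes X: "local_object C X" and "finite F"
    and "\<And>j. j \<in> F \<Longrightarrow> f j \<in> Hom C X X" and "is_iso C X X (arr_sum X X f F)"
  shows "\<exists>j\<in>F. is_iso C X X (f j)"
proof (rule ccontr)
  assume n: "\<not> ?thesis"
  have o: "X \<in> Obj C" using X local_object_obj by simp
  have "\<not> is_iso C X X (arr_sum X X f F)"
    using assms(2,3) n
  proof (induction F)
    case empty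
    then show ?case using zero_not_iso[OF local_object_Ident[OF X] o o] o by (simp add: arr_sum_empty)
  next
    case (insert j F)
    have "arr_sum X X f (insert j F) = Plus C (f j) (arr_sum X X f F)"
      using insert o by (intro arr_sum_insert) auto
    moreover have "arr_sum X X f F \<in> Hom C X X" using insert o by (intro arr_sum_closed) auto
    ultimately show ?case using insert nonunit_Plus[OF X] by simp
  qed
  then show False using assms by simp
qed

text \<open>Gaussian elimination for a factorisation \<open>B A = 1\<close> of an identity matrix through the objects
  \<open>Y j\<close>. Some summand \<open>B m j \<cdot> A j m\<close> of the last diagonal entry is invertible, so \<open>B m j\<close> is an
  isomorphism; subtracting multiples of the last row of \<open>B\<close> from the others clears its column \<open>j\<close>
  and changes only the last column of \<open>B A\<close>. This leaves a factorisation of a smaller identity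
  matrix through one object less.\<close>

lemma local_matrix_rank:
  assumes X: "local_object C X" and "finite F" and "\<And>j. j \<in> F \<Longrightarrow> local_object C (Y j)"
    and "\<And>a j. a < m \<Longrightarrow> j \<in> F \<Longrightarrow> B a j \<in> Hom C (Y j) X"
    and "\<And>c j. c < m \<Longrightarrow> j \<in> F \<Longrightarrow> A j c \<in> Hom C X (Y j)"
    and "\<And>a c. a < m \<Longrightarrow> c < m \<Longrightarrow> arr_sum X X (\<lambda>j. B a j \<cdot> A j c) F
          = (if a = c then Ident C X else ZeroArr C X X)"
  shows "m \<le> card {j \<in> F. isomorphic C (Y j) X}"
  using assms(2-)
proof (induction m arbitrary: F B A)
  case 0
  then show ?case by simp
next
  case (Suc m)
  note Y = Suc.prems(2) and BH = Suc.prems(3) and AH = Suc.prems(4)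
  have o: "X \<in> Obj C" using X local_object_obj by simp
  have BA: "B a j \<cdot> A j c \<in> Hom C X X" if "a < Suc m" "c < Suc m" "j \<in> F" for a c j
    using that BH AH Comp_closed by blast
  obtain l where l: "l \<in> F" "is_iso C X X (B m l \<cdot> A l m)"
    using iso_summand[OF X Suc.prems(1), of "\<lambda>j. B m j \<cdot> A j m"] BA Suc.prems(5)[of m m]
      is_iso_Ident[OF o] by auto
  have Bml: "is_iso C (Y l) X (B m l)"
    using iso_factors_if_local(2)[OF local_object_Ident[OF X] Y AH BH] l by blast
  then obtain v where v: "v \<in> Hom C X (Y l)" "v \<cdot> B m l = Ident C (Y l)"
    unfolding is_iso_def by blast
  define r where "r a = neg X X (B a l \<cdot> v)" for a
  have r: "r a \<in> Hom C X X" if "a < Suc m" for a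
    unfolding r_def using that BH l v Comp_closed neg_closed by blast
  define B' where "B' a j = Plus C (B a j) (r a \<cdot> B m j)" for a j
  have rB: "r a \<cdot> B m j \<in> Hom C (Y j) X" if "a < Suc m" "j \<in> F" for a j
    using that r BH Comp_closed by blast
  have B'H: "B' a j \<in> Hom C (Y j) X" if "a < Suc m" "j \<in> F" for a j
    unfolding B'_def using that BH rB Plus_closed by blast
  have B'l: "B' a l = ZeroArr C (Y l) X" if a: "a < Suc m" for a
  proof -
    have BalH: "B a l \<in> Hom C (Y l) X" using BH a l by blast
    have BmlH: "B m l \<in> Hom C (Y l) X" using BH l by blast
    have "r a \<cdot> B m l = neg (Y l) X ((B a l \<cdot> v) \<cdot> B m l)"
      unfolding r_def by (rule neg_Comp[OF BmlH Comp_closed[OF v(1) BalH]])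
    also have "(B a l \<cdot> v) \<cdot> B m l = B a l"
      using Comp_assoc[OF BmlH v(1) BalH] v(2) Comp_Ident[OF BalH] by simp
    finally show ?thesis unfolding B'_def using Plus_neg[OF BalH] by simp
  qed
  have S: "arr_sum X X (\<lambda>j. B' a j \<cdot> A j c) (F - {l})
      = Plus C (arr_sum X X (\<lambda>j. B a j \<cdot> A j c) F) (r a \<cdot> arr_sum X X (\<lambda>j. B m j \<cdot> A j c) F)"
    if a: "a < Suc m" and c: "c < Suc m" for a c
  proof -
    have "arr_sum X X (\<lambda>j. B' a j \<cdot> A j c) (F - {l}) = arr_sum X X (\<lambda>j. B' a j \<cdot> A j c) F"
    proof (rule arr_sum_mono_neutral)
      show "B' a j \<cdot> A j c = ZeroArr C X X" if "j \<in> F - (F - {l})" for j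
        using that B'l[OF a] Zero_Comp[OF AH[OF c]] l o by auto
      show "B' a j \<cdot> A j c \<in> Hom C X X" if "j \<in> F - {l}" for j
        using that B'H[OF a] AH[OF c] Comp_closed by blast
    qed (use o Suc.prems(1) in auto)
    also have "\<dots> = arr_sum X X (\<lambda>j. Plus C (B a j \<cdot> A j c) (r a \<cdot> B m j \<cdot> A j c)) F"
    proof (rule arr_sum_cong)
      show "B' a j \<cdot> A j c \<in> Hom C X X" if "j \<in> F" for j
        using that B'H[OF a] AH[OF c] Comp_closed by blast
      show "B' a j \<cdot> A j c = Plus C (B a j \<cdot> A j c) (r a \<cdot> B m j \<cdot> A j c)" if "j \<in> F" for j
        unfolding B'_def
        using Plus_Comp[OF AH[OF c that] BH[OF a that] rB[OF a that]]
          Comp_assoc[OF AH[OF c that] BH[of m, OF _ that] r[OF a]] by simp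
    qed (use o in auto)
    also have "\<dots> = Plus C (arr_sum X X (\<lambda>j. B a j \<cdot> A j c) F)
        (arr_sum X X (\<lambda>j. r a \<cdot> B m j \<cdot> A j c) F)"
      using o BA a c r[OF a] Comp_closed by (intro arr_sum_Plus) blast+
    also have "arr_sum X X (\<lambda>j. r a \<cdot> B m j \<cdot> A j c) F = r a \<cdot> arr_sum X X (\<lambda>j. B m j \<cdot> A j c) F"
      using Suc.prems(1) o BA c r[OF a] by (intro Comp_arr_sum[symmetric]) auto
    finally show ?thesis .
  qed
  have "m \<le> card {j \<in> F - {l}. isomorphic C (Y j) X}"
  proof (rule Suc.IH[of "F - {l}" B' A])
    fix a c assume ac: "a < m" "c < m"
    then have "r a \<cdot> arr_sum X X (\<lambda>j. B m j \<cdot> A j c) F = ZeroArr C X X"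
      using Suc.prems(5)[of m c] Comp_Zero[OF r o] by simp
    then have "arr_sum X X (\<lambda>j. B' a j \<cdot> A j c) (F - {l})
        = Plus C (arr_sum X X (\<lambda>j. B a j \<cdot> A j c) F) (ZeroArr C X X)"
      using S[of a c] ac by simp
    then show "arr_sum X X (\<lambda>j. B' a j \<cdot> A j c) (F - {l})
        = (if a = c then Ident C X else ZeroArr C X X)"
      using Suc.prems(5)[of a c] ac Plus_Zero Ident_closed[OF o] Zero_closed[OF o o] by simp
  qed (use Suc.prems(1) Y B'H AH in auto)
  moreover have "isomorphic C (Y l) X"
    unfolding isomorphic_iff using Bml Hom_objs[OF v(1)] by blast
  then have "{j \<in> F. isomorphic C (Y j) X} = insert l {j \<in> F - {l}. isomorphic C (Y j) X}"
    using l by blast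
  ultimately show ?case using Suc.prems(1) by simp
qed

end

section \<open>Coproducts and direct sums\<close>

lemma is_biproduct_coproduct: "is_biproduct C J Y P \<iota> \<Longrightarrow> is_coproduct C J Y P \<iota>"
  by (simp add: is_biproduct_def)

lemma lessThan_2: "{..<2::nat} = {0, 1}"
  by auto

context category
begin

lemma coproduct_objs:
  assumes "is_coproduct C J Y P \<iota>"
  shows "P \<in> Obj C" "j \<in> J \<Longrightarrow> Y j \<in> Obj C" "j \<in> J \<Longrightarrow> \<iota> j \<in> Hom C (Y j) P"
  using assms by (auto simp: is_coproduct_def)

lemma coproduct_ex1:
  assumes "is_coproduct C J Y P \<iota>" "Z \<in> Obj C" "\<And>j. j \<in> J \<Longrightarrow> g j \<in> Hom C (Y j) Z"
  shows "\<exists>!h. h \<in> Hom C P Z \<and> (\<forall>j\<in>J. h \<cdot> \<iota> j = g j)"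
  by (rule assms(1)[unfolded is_coproduct_def, THEN conjunct2, THEN conjunct2, THEN bspec,
        OF assms(2), THEN spec[of _ g], THEN mp]) (simp add: assms(3))

lemma coproduct_desc:
  assumes "is_coproduct C J Y P \<iota>" "Z \<in> Obj C" "\<And>j. j \<in> J \<Longrightarrow> g j \<in> Hom C (Y j) Z"
  obtains h where "h \<in> Hom C P Z" "\<And>j. j \<in> J \<Longrightarrow> h \<cdot> \<iota> j = g j"
  using coproduct_ex1[OF assms] by blast

lemma coproduct_ext:
  assumes P: "is_coproduct C J Y P \<iota>" and f: "f \<in> Hom C P Z" and g: "g \<in> Hom C P Z"
    and eq: "\<And>j. j \<in> J \<Longrightarrow> f \<cdot> \<iota> j = g \<cdot> \<iota> j"
  shows "f = g"
proof -
  have Z: "Z \<in> Obj C" using f Hom_objs by blast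
  have "f \<cdot> \<iota> j \<in> Hom C (Y j) Z" if "j \<in> J" for j
    using Comp_closed[OF coproduct_objs(3)[OF P that] f] .
  then have "\<exists>!h. h \<in> Hom C P Z \<and> (\<forall>j\<in>J. h \<cdot> \<iota> j = f \<cdot> \<iota> j)"
    by (rule coproduct_ex1[OF P Z])
  then show ?thesis using f g eq by metis
qed

lemma coproduct_unique:
  assumes P: "is_coproduct C J Y P \<iota>" and Q: "is_coproduct C J Y Q \<kappa>"
  shows "isomorphic C P Q"
proof -
  obtain u where u: "u \<in> Hom C P Q" "\<And>j. j \<in> J \<Longrightarrow> u \<cdot> \<iota> j = \<kappa> j"
    using coproduct_desc[OF P] coproduct_objs[OF Q] by blast
  obtain v where v: "v \<in> Hom C Q P" "\<And>j. j \<in> J \<Longrightarrow> v \<cdot> \<kappa> j = \<iota> j"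
    using coproduct_desc[OF Q] coproduct_objs[OF P] by blast
  have "v \<cdot> u = Ident C P"
  proof (rule coproduct_ext[OF P, where Z = P])
    show "(v \<cdot> u) \<cdot> \<iota> j = Ident C P \<cdot> \<iota> j" if "j \<in> J" for j
      using u(2)[OF that] v(2)[OF that] Comp_assoc[OF coproduct_objs(3)[OF P that] u(1) v(1)]
        Ident_Comp[OF coproduct_objs(3)[OF P that]] by simp
  qed (use u v coproduct_objs[OF P] Comp_closed Ident_closed in auto)
  moreover have "u \<cdot> v = Ident C Q"
  proof (rule coproduct_ext[OF Q, where Z = Q])
    show "(u \<cdot> v) \<cdot> \<kappa> j = Ident C Q \<cdot> \<kappa> j" if "j \<in> J" for j
      using u(2)[OF that] v(2)[OF that] Comp_assoc[OF coproduct_objs(3)[OF Q that] v(1) u(1)]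
        Ident_Comp[OF coproduct_objs(3)[OF Q that]] by simp
  qed (use u v coproduct_objs[OF Q] Comp_closed Ident_closed in auto)
  ultimately show ?thesis
    unfolding isomorphic_def using u v coproduct_objs[OF P] coproduct_objs[OF Q] by blast
qed

lemma coproduct_reindex:
  assumes P: "is_coproduct C J Y P \<iota>" and \<sigma>: "bij_betw \<sigma> K J"
    and u: "\<And>k. k \<in> K \<Longrightarrow> is_iso C (Z k) (Y (\<sigma> k)) (u k)"
  shows "is_coproduct C K Z P (\<lambda>k. \<iota> (\<sigma> k) \<cdot> u k)"
proof -
  have \<sigma>J: "\<sigma> k \<in> J" if "k \<in> K" for k using \<sigma> that bij_betwE by blast
  define \<tau> where "\<tau> = inv_into K \<sigma>"
  have \<tau>: "\<tau> j \<in> K" "\<sigma> (\<tau> j) = j" if "j \<in> J" for j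
    using \<sigma> that unfolding \<tau>_def bij_betw_def by (auto simp: inv_into_into f_inv_into_f)
  have \<tau>\<sigma>: "\<tau> (\<sigma> k) = k" if "k \<in> K" for k
    using \<sigma> that unfolding \<tau>_def bij_betw_def by (auto simp: inv_into_f_f)
  have uH: "u k \<in> Hom C (Z k) (Y (\<sigma> k))" if "k \<in> K" for k using that u is_iso_Hom by blast
  obtain v where v: "\<And>k. k \<in> K \<Longrightarrow> v k \<in> Hom C (Y (\<sigma> k)) (Z k) \<and> v k \<cdot> u k = Ident C (Z k)
      \<and> u k \<cdot> v k = Ident C (Y (\<sigma> k))"
    using u unfolding is_iso_def by metis
  have \<iota>H: "\<iota> (\<sigma> k) \<in> Hom C (Y (\<sigma> k)) P" if "k \<in> K" for k
    using that coproduct_objs[OF P] \<sigma>J by blast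
  have ex1: "\<exists>!h. h \<in> Hom C P W \<and> (\<forall>k\<in>K. h \<cdot> (\<iota> (\<sigma> k) \<cdot> u k) = g k)"
    if W: "W \<in> Obj C" and g: "\<forall>k\<in>K. g k \<in> Hom C (Z k) W" for W g
  proof -
    have transl: "h \<cdot> (\<iota> (\<sigma> k) \<cdot> u k) = g k \<longleftrightarrow> h \<cdot> \<iota> (\<sigma> k) = g k \<cdot> v k"
      if h: "h \<in> Hom C P W" and k: "k \<in> K" for h k
    proof -
      have hi: "h \<cdot> \<iota> (\<sigma> k) \<in> Hom C (Y (\<sigma> k)) W" using h \<iota>H[OF k] Comp_closed by blast
      have a: "h \<cdot> (\<iota> (\<sigma> k) \<cdot> u k) = (h \<cdot> \<iota> (\<sigma> k)) \<cdot> u k"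
        using Comp_assoc[OF uH[OF k] \<iota>H[OF k] h] by simp
      have b: "((h \<cdot> \<iota> (\<sigma> k)) \<cdot> u k) \<cdot> v k = h \<cdot> \<iota> (\<sigma> k)"
        using Comp_assoc[OF v[OF k, THEN conjunct1] uH[OF k] hi] v[OF k] Comp_Ident[OF hi] by simp
      have c: "(g k \<cdot> v k) \<cdot> u k = g k"
        using Comp_assoc[OF uH[OF k] v[OF k, THEN conjunct1] g[rule_format, OF k]] v[OF k]
          Comp_Ident[OF g[rule_format, OF k]] by simp
      show ?thesis using a b c by metis
    qed
    obtain h where h: "h \<in> Hom C P W" "\<And>j. j \<in> J \<Longrightarrow> h \<cdot> \<iota> j = g (\<tau> j) \<cdot> v (\<tau> j)"
    proof (rule coproduct_desc[OF P W, of "\<lambda>j. g (\<tau> j) \<cdot> v (\<tau> j)"])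
      show "g (\<tau> j) \<cdot> v (\<tau> j) \<in> Hom C (Y j) W" if "j \<in> J" for j
        using \<tau>[OF that] g v[of "\<tau> j"] Comp_closed by auto
    qed (rule that; blast)
    show ?thesis
    proof (rule ex1I[of _ h])
      show "h \<in> Hom C P W \<and> (\<forall>k\<in>K. h \<cdot> (\<iota> (\<sigma> k) \<cdot> u k) = g k)"
        using h transl \<sigma>J \<tau>\<sigma> by auto
      fix h' assume h': "h' \<in> Hom C P W \<and> (\<forall>k\<in>K. h' \<cdot> (\<iota> (\<sigma> k) \<cdot> u k) = g k)"
      have "h' \<cdot> \<iota> j = g (\<tau> j) \<cdot> v (\<tau> j)" if "j \<in> J" for j
        using transl[of h' "\<tau> j"] h' \<tau>[OF that] by auto
      then show "h' = h" using coproduct_ext[OF P, of h' W h] h h' by auto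
    qed
  qed
  have "Z k \<in> Obj C \<and> \<iota> (\<sigma> k) \<cdot> u k \<in> Hom C (Z k) P" if "k \<in> K" for k
    using Comp_closed[OF uH[OF that] \<iota>H[OF that]] Hom_objs by blast
  then show ?thesis
    unfolding is_coproduct_def using coproduct_objs(1)[OF P] ex1 by simp
qed

lemma coproduct_isomorphic:
  assumes P: "is_coproduct C J Y P \<iota>" and u: "is_iso C P Q u"
  shows "is_coproduct C J Y Q (\<lambda>j. u \<cdot> \<iota> j)" (is "is_coproduct _ _ _ _ ?\<kappa>")
proof -
  obtain v where u: "u \<in> Hom C P Q" and v: "v \<in> Hom C Q P"
    and vu: "v \<cdot> u = Ident C P" and uv: "u \<cdot> v = Ident C Q"
    using u unfolding is_iso_def by blast
  note oP = coproduct_objs[OF P]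
  have Q: "Q \<in> Obj C" using u Hom_objs by blast
  have v\<kappa>: "v \<cdot> (u \<cdot> \<iota> j) = \<iota> j" if "j \<in> J" for j
    using Comp_assoc[OF oP(3)[OF that] u v] vu Ident_Comp[OF oP(3)[OF that]] by simp
  have huv: "(h \<cdot> u) \<cdot> v = h" if "h \<in> Hom C Q W" for h W
    using Comp_assoc[OF v u that] uv Comp_Ident[OF that] by simp
  have ex1: "\<exists>!h. h \<in> Hom C Q W \<and> (\<forall>j\<in>J. h \<cdot> ?\<kappa> j = g j)"
    if W: "W \<in> Obj C" and g: "\<forall>j\<in>J. g j \<in> Hom C (Y j) W" for W g
  proof -
    obtain h where h: "h \<in> Hom C P W" "\<And>j. j \<in> J \<Longrightarrow> h \<cdot> \<iota> j = g j"
      using coproduct_desc[OF P W] g by blast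
    show ?thesis
    proof (rule ex1I[of _ "h \<cdot> v"])
      show "h \<cdot> v \<in> Hom C Q W \<and> (\<forall>j\<in>J. (h \<cdot> v) \<cdot> ?\<kappa> j = g j)"
      proof (intro conjI ballI)
        show "h \<cdot> v \<in> Hom C Q W" using h v Comp_closed by blast
        fix j assume j: "j \<in> J"
        show "(h \<cdot> v) \<cdot> ?\<kappa> j = g j"
          using Comp_assoc[OF Comp_closed[OF oP(3)[OF j] u] v h(1)] v\<kappa>[OF j] h(2)[OF j] by simp
      qed
      fix h' assume h': "h' \<in> Hom C Q W \<and> (\<forall>j\<in>J. h' \<cdot> ?\<kappa> j = g j)"
      have "h' \<cdot> u = h"
      proof (rule coproduct_ext[OF P])
        show "(h' \<cdot> u) \<cdot> \<iota> j = h \<cdot> \<iota> j" if "j \<in> J" for j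
          using h h' that Comp_assoc[OF oP(3)[OF that] u] by auto
      qed (use h h' u Comp_closed in auto)
      then show "h' = h \<cdot> v" using huv h' by metis
    qed
  qed
  show ?thesis
    unfolding is_coproduct_def using Q oP Comp_closed[OF _ u] ex1 by simp
qed

text \<open>Associativity of coproducts, in the form in which decompositions of two objects combine to one
  of their direct sum.\<close>

lemma coproduct_sum:
  assumes P: "is_coproduct C {..<2} ((!) [A, B]) P \<kappa>"
    and A: "is_coproduct C J Y A \<iota>" and B: "is_coproduct C K Z B \<mu>"
  shows "is_coproduct C (J <+> K) (case_sum Y Z) P
    (case_sum (\<lambda>j. \<kappa> 0 \<cdot> \<iota> j) (\<lambda>k. \<kappa> 1 \<cdot> \<mu> k))" (is "is_coproduct _ _ _ _ ?q")
proof -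
  have \<kappa>: "\<kappa> 0 \<in> Hom C A P" "\<kappa> 1 \<in> Hom C B P"
    using coproduct_objs(3)[OF P, of 0] coproduct_objs(3)[OF P, of 1] by auto
  have q: "?q x \<in> Hom C (case_sum Y Z x) P" if "x \<in> J <+> K" for x
    using that Comp_closed[OF coproduct_objs(3)[OF A] \<kappa>(1)]
      Comp_closed[OF coproduct_objs(3)[OF B] \<kappa>(2)] by auto
  have ex1: "\<exists>!h. h \<in> Hom C P W \<and> (\<forall>x \<in> J <+> K. h \<cdot> ?q x = g x)"
    if W: "W \<in> Obj C" and g: "\<forall>x \<in> J <+> K. g x \<in> Hom C (case_sum Y Z x) W" for W g
  proof -
    have gl: "g (Inl j) \<in> Hom C (Y j) W" if "j \<in> J" for j using g[rule_format, of "Inl j"] that by auto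
    have gr: "g (Inr k) \<in> Hom C (Z k) W" if "k \<in> K" for k using g[rule_format, of "Inr k"] that by auto
    obtain a where a: "a \<in> Hom C A W" "\<And>j. j \<in> J \<Longrightarrow> a \<cdot> \<iota> j = g (Inl j)"
      using coproduct_desc[OF A W, of "\<lambda>j. g (Inl j)"] gl by blast
    obtain b where b: "b \<in> Hom C B W" "\<And>k. k \<in> K \<Longrightarrow> b \<cdot> \<mu> k = g (Inr k)"
      using coproduct_desc[OF B W, of "\<lambda>k. g (Inr k)"] gr by blast
    obtain h where h: "h \<in> Hom C P W" "\<And>l. l \<in> {..<2::nat} \<Longrightarrow> h \<cdot> \<kappa> l = [a, b] ! l"
    proof (rule coproduct_desc[OF P W, of "(!) [a, b]"])
      show "[a, b] ! l \<in> Hom C ([A, B] ! l) W" if "l \<in> {..<2}" for l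
        using that a b by (auto simp: lessThan_2)
    qed (rule that; blast)
    have h01: "h \<cdot> \<kappa> 0 = a" "h \<cdot> \<kappa> 1 = b" using h(2)[of 0] h(2)[of 1] by auto
    have assoc: "f \<cdot> (\<kappa> 0 \<cdot> \<iota> j) = (f \<cdot> \<kappa> 0) \<cdot> \<iota> j" if "f \<in> Hom C P W" "j \<in> J" for f j
      using that Comp_assoc[OF coproduct_objs(3)[OF A] \<kappa>(1)] by simp
    have assoc': "f \<cdot> (\<kappa> 1 \<cdot> \<mu> k) = (f \<cdot> \<kappa> 1) \<cdot> \<mu> k" if "f \<in> Hom C P W" "k \<in> K" for f k
      using that Comp_assoc[OF coproduct_objs(3)[OF B] \<kappa>(2)] by simp
    show ?thesis
    proof (rule ex1I[of _ h])
      show "h \<in> Hom C P W \<and> (\<forall>x \<in> J <+> K. h \<cdot> ?q x = g x)"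
        using h(1) h01 assoc assoc' a b by auto
      fix h' assume h': "h' \<in> Hom C P W \<and> (\<forall>x \<in> J <+> K. h' \<cdot> ?q x = g x)"
      have "h' \<cdot> \<kappa> 0 = a"
      proof (rule coproduct_ext[OF A])
        show "(h' \<cdot> \<kappa> 0) \<cdot> \<iota> j = a \<cdot> \<iota> j" if "j \<in> J" for j
          using h'[THEN conjunct2, rule_format, of "Inl j"] assoc[of h' j] h' a that by auto
      qed (use h' \<kappa> Comp_closed a in auto)
      moreover have "h' \<cdot> \<kappa> 1 = b"
      proof (rule coproduct_ext[OF B])
        show "(h' \<cdot> \<kappa> 1) \<cdot> \<mu> k = b \<cdot> \<mu> k" if "k \<in> K" for k
          using h'[THEN conjunct2, rule_format, of "Inr k"] assoc'[of h' k] h' b that by auto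
      qed (use h' \<kappa> Comp_closed b in auto)
      ultimately have "h' \<cdot> \<kappa> l = h \<cdot> \<kappa> l" if "l \<in> {..<2}" for l
        using that h01 unfolding lessThan_2 by auto
      then show "h' = h" by (rule coproduct_ext[OF P h'[THEN conjunct1] h(1)])
    qed
  qed
  have "case_sum Y Z x \<in> Obj C" if "x \<in> J <+> K" for x using q[OF that] Hom_objs by blast
  then show ?thesis
    unfolding is_coproduct_def using coproduct_objs(1)[OF P] ex1 q by simp
qed

end

context preadditive_category
begin

lemma canonical_proj:
  assumes P: "is_coproduct C J Y P \<iota>" and j: "j \<in> J"
  shows "canonical_proj C J Y P \<iota> j \<in> Hom C P (Y j)"
    and "k \<in> J \<Longrightarrow> canonical_proj C J Y P \<iota> j \<cdot> \<iota> k
           = (if k = j then Ident C (Y j) else ZeroArr C (Y k) (Y j))"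
proof -
  let ?g = "\<lambda>k. if k = j then Ident C (Y j) else ZeroArr C (Y k) (Y j)"
  have o: "Y k \<in> Obj C" if "k \<in> J" for k using coproduct_objs[OF P] that by blast
  have "\<exists>!p. p \<in> Hom C P (Y j) \<and> (\<forall>k\<in>J. p \<cdot> \<iota> k = ?g k)"
    by (rule coproduct_ex1[OF P o[OF j]]) (use o j Ident_closed Zero_closed in auto)
  from theI'[OF this]
  show "canonical_proj C J Y P \<iota> j \<in> Hom C P (Y j)"
    "k \<in> J \<Longrightarrow> canonical_proj C J Y P \<iota> j \<cdot> \<iota> k
           = (if k = j then Ident C (Y j) else ZeroArr C (Y k) (Y j))"
    unfolding canonical_proj_def by auto
qed

lemma canonical_proj_unique:
  assumes P: "is_coproduct C J Y P \<iota>" and j: "j \<in> J" and p: "p \<in> Hom C P (Y j)"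
    and "\<And>k. k \<in> J \<Longrightarrow> p \<cdot> \<iota> k = (if k = j then Ident C (Y j) else ZeroArr C (Y k) (Y j))"
  shows "canonical_proj C J Y P \<iota> j = p"
  by (rule coproduct_ext[OF P canonical_proj(1)[OF P j] p]) (use assms canonical_proj(2)[OF P j] in auto)

text \<open>Indecomposability of an object constrains the biproduct structures on that object itself, so a
  decomposition of an isomorphic object has to be transported.\<close>

lemma biproduct_isomorphic:
  assumes P: "is_biproduct C J Y P \<iota>" and "isomorphic C P Q"
  shows "\<exists>\<kappa>. is_biproduct C J Y Q \<kappa>"
proof -
  obtain u v where u: "u \<in> Hom C P Q" and v: "v \<in> Hom C Q P"
    and vu: "v \<cdot> u = Ident C P" and uv: "u \<cdot> v = Ident C Q"
    using assms(2) unfolding isomorphic_def by blast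
  have cP: "is_coproduct C J Y P \<iota>" by (rule is_biproduct_coproduct[OF P])
  note oP = coproduct_objs[OF cP]
  have cQ: "is_coproduct C J Y Q (\<lambda>j. u \<cdot> \<iota> j)" (is "is_coproduct _ _ _ _ ?\<kappa>")
    by (rule coproduct_isomorphic[OF cP is_isoI[OF u v vu uv]])
  have v\<kappa>: "v \<cdot> (u \<cdot> \<iota> j) = \<iota> j" if "j \<in> J" for j
    using Comp_assoc[OF oP(3)[OF that] u v] vu Ident_Comp[OF oP(3)[OF that]] by simp
  have proj: "canonical_proj C J Y Q ?\<kappa> j = canonical_proj C J Y P \<iota> j \<cdot> v" if j: "j \<in> J" for j
  proof (rule canonical_proj_unique[OF cQ j])
    note p = canonical_proj[OF cP j]
    show "canonical_proj C J Y P \<iota> j \<cdot> v \<in> Hom C Q (Y j)" using p v Comp_closed by blast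
    show "(canonical_proj C J Y P \<iota> j \<cdot> v) \<cdot> ?\<kappa> k
        = (if k = j then Ident C (Y j) else ZeroArr C (Y k) (Y j))" if "k \<in> J" for k
      using Comp_assoc[OF Comp_closed[OF oP(3)[OF that] u] v p(1)] v\<kappa>[OF that] p(2)[OF that] by simp
  qed
  have "bij_betw (\<lambda>h. \<lambda>j\<in>J. canonical_proj C J Y Q ?\<kappa> j \<cdot> h) (Hom C Z Q) (\<Pi>\<^sub>E j\<in>J. Hom C Z (Y j))"
    if Z: "Z \<in> Obj C" for Z
  proof -
    have b1: "bij_betw (\<lambda>h. v \<cdot> h) (Hom C Z Q) (Hom C Z P)"
    proof (rule bij_betwI[of _ _ _ "\<lambda>h. u \<cdot> h"])
      show "u \<cdot> v \<cdot> h = h" if "h \<in> Hom C Z Q" for h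
        using Comp_assoc[OF that v u] uv Ident_Comp[OF that] by simp
      show "v \<cdot> u \<cdot> h = h" if "h \<in> Hom C Z P" for h
        using Comp_assoc[OF that u v] vu Ident_Comp[OF that] by simp
    qed (use u v Comp_closed in auto)
    have b2: "bij_betw (\<lambda>h. \<lambda>j\<in>J. canonical_proj C J Y P \<iota> j \<cdot> h) (Hom C Z P) (\<Pi>\<^sub>E j\<in>J. Hom C Z (Y j))"
      using P Z unfolding is_biproduct_def by blast
    have "(\<lambda>j\<in>J. canonical_proj C J Y Q ?\<kappa> j \<cdot> h) = (\<lambda>j\<in>J. canonical_proj C J Y P \<iota> j \<cdot> (v \<cdot> h))"
      if "h \<in> Hom C Z Q" for h
      using proj Comp_assoc[OF that v canonical_proj(1)[OF cP]] by (auto intro!: restrict_ext)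
    then show ?thesis
      using bij_betw_trans[OF b1 b2] by (subst bij_betw_cong) auto
  qed
  then show ?thesis unfolding is_biproduct_def using cQ by blast
qed

lemma direct_sum_isomorphic: "direct_sum C A B Y \<Longrightarrow> isomorphic C Y Y' \<Longrightarrow> direct_sum C A B Y'"
  unfolding direct_sum_def by (elim exE) (rule biproduct_isomorphic)

lemma direct_sum_split:
  assumes "direct_sum C A B Y"
  obtains i j p q where "i \<in> Hom C A Y" "j \<in> Hom C B Y" "p \<in> Hom C Y A" "q \<in> Hom C Y B"
    "p \<cdot> i = Ident C A" "q \<cdot> j = Ident C B" "q \<cdot> i = ZeroArr C A B" "p \<cdot> j = ZeroArr C B A"
    "Plus C (i \<cdot> p) (j \<cdot> q) = Ident C Y"
proof -
  obtain \<iota> where b: "is_biproduct C {..<2} ((!) [A, B]) Y \<iota>"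
    using assms unfolding direct_sum_def by (elim exE)
  note c = is_biproduct_coproduct[OF b]
  define p q where "p = canonical_proj C {..<2} ((!) [A, B]) Y \<iota> 0"
    and "q = canonical_proj C {..<2} ((!) [A, B]) Y \<iota> 1"
  have \<iota>: "\<iota> 0 \<in> Hom C A Y" "\<iota> 1 \<in> Hom C B Y"
    using coproduct_objs(3)[OF c, of 0] coproduct_objs(3)[OF c, of 1] by auto
  have p: "p \<in> Hom C Y A" "p \<cdot> \<iota> 0 = Ident C A" "p \<cdot> \<iota> 1 = ZeroArr C B A"
    using canonical_proj(1)[OF c, of 0] canonical_proj(2)[OF c, of 0 0] canonical_proj(2)[OF c, of 0 1]
    unfolding p_def by auto
  have q: "q \<in> Hom C Y B" "q \<cdot> \<iota> 1 = Ident C B" "q \<cdot> \<iota> 0 = ZeroArr C A B"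
    using canonical_proj(1)[OF c, of 1] canonical_proj(2)[OF c, of 1 0] canonical_proj(2)[OF c, of 1 1]
    unfolding q_def by auto
  have ip: "\<iota> 0 \<cdot> p \<in> Hom C Y Y" "\<iota> 1 \<cdot> q \<in> Hom C Y Y" using \<iota> p q Comp_closed by blast+
  have o: "A \<in> Obj C" "B \<in> Obj C" "Y \<in> Obj C" using \<iota> Hom_objs by auto
  have "Plus C (\<iota> 0 \<cdot> p) (\<iota> 1 \<cdot> q) = Ident C Y"
  proof (rule coproduct_ext[OF c])
    fix l assume "l \<in> {..<2::nat}"
    then consider "l = 0" | "l = 1" by (auto simp: lessThan_2)
    then show "Plus C (\<iota> 0 \<cdot> p) (\<iota> 1 \<cdot> q) \<cdot> \<iota> l = Ident C Y \<cdot> \<iota> l"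
    proof cases
      case 1
      have "Plus C (\<iota> 0 \<cdot> p) (\<iota> 1 \<cdot> q) \<cdot> \<iota> 0 = Plus C (\<iota> 0) (ZeroArr C A Y)"
        using Plus_Comp[OF \<iota>(1) ip] Comp_assoc[OF \<iota>(1) p(1) \<iota>(1)] Comp_assoc[OF \<iota>(1) q(1) \<iota>(2)]
          p q Comp_Ident[OF \<iota>(1)] Comp_Zero[OF \<iota>(2)] o by simp
      then show ?thesis using 1 Plus_Zero[OF \<iota>(1)] Ident_Comp[OF \<iota>(1)] by simp
    next
      case 2
      have "Plus C (\<iota> 0 \<cdot> p) (\<iota> 1 \<cdot> q) \<cdot> \<iota> 1 = Plus C (ZeroArr C B Y) (\<iota> 1)"
        using Plus_Comp[OF \<iota>(2) ip] Comp_assoc[OF \<iota>(2) p(1) \<iota>(1)] Comp_assoc[OF \<iota>(2) q(1) \<iota>(2)]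
          p q Comp_Ident[OF \<iota>(2)] Comp_Zero[OF \<iota>(1)] o by simp
      then show ?thesis using 2 Zero_Plus[OF \<iota>(2)] Ident_Comp[OF \<iota>(2)] by simp
    qed
  qed (use ip o Plus_closed Ident_closed in auto)
  then show ?thesis using that \<iota> p q by blast
qed

lemma direct_sum_zero_right:
  assumes "direct_sum C A B Y" "zero_object C B"
  shows "isomorphic C A Y"
proof -
  obtain i j p q where h: "i \<in> Hom C A Y" "j \<in> Hom C B Y" "p \<in> Hom C Y A" "q \<in> Hom C Y B"
    "p \<cdot> i = Ident C A" "Plus C (i \<cdot> p) (j \<cdot> q) = Ident C Y"
    using direct_sum_split[OF assms(1)] by metis
  have o: "A \<in> Obj C" "B \<in> Obj C" "Y \<in> Obj C" using h Hom_objs by auto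
  have "q = ZeroArr C Y B"
    using assms(2) h(4) o Zero_closed unfolding zero_object_def by blast
  then have "j \<cdot> q = ZeroArr C Y Y" using Comp_Zero h(2) o by simp
  then have "i \<cdot> p = Ident C Y" using h Plus_Zero[OF Comp_closed[OF h(3,1)]] by simp
  then show ?thesis unfolding isomorphic_def using o h by blast
qed

text \<open>The idempotents of a decomposition \<open>X \<cong> A \<oplus> B\<close> add up to the identity, so one of them is
  invertible and then annihilates the other.\<close>

lemma local_object_indecomposable:
  assumes X: "local_object C X"
  shows "indecomposable C X"
proof -
  have main: "zero_object C B"
    if h: "i \<in> Hom C A X" "j \<in> Hom C B X" "p \<in> Hom C X A" "q \<in> Hom C X B"
      "q \<cdot> j = Ident C B" "q \<cdot> i = ZeroArr C A B" and u: "is_iso C X X (i \<cdot> p)" for A B i j p q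
  proof -
    have o: "A \<in> Obj C" "B \<in> Obj C" "X \<in> Obj C" using h Hom_objs by auto
    obtain w where w: "w \<in> Hom C X X" "(i \<cdot> p) \<cdot> w = Ident C X" using u unfolding is_iso_def by blast
    have "q = q \<cdot> ((i \<cdot> p) \<cdot> w)" using w Comp_Ident[OF h(4)] by simp
    also have "\<dots> = (q \<cdot> i) \<cdot> (p \<cdot> w)" using h(1-4) w(1) by (simp add: Hom_def arr_simps)
    also have "\<dots> = ZeroArr C X B" using h(6) Zero_Comp[OF Comp_closed[OF w(1) h(3)]] o by simp
    finally have "Ident C B = ZeroArr C B B" using h(5) Zero_Comp[OF h(2)] o by simp
    then show ?thesis using zero_object_iff o by blast
  qed
  have "zero_object C A \<or> zero_object C B" if d: "direct_sum C A B X" for A B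
  proof -
    obtain i j p q where h: "i \<in> Hom C A X" "j \<in> Hom C B X" "p \<in> Hom C X A" "q \<in> Hom C X B"
      "p \<cdot> i = Ident C A" "q \<cdot> j = Ident C B" "q \<cdot> i = ZeroArr C A B" "p \<cdot> j = ZeroArr C B A"
      "Plus C (i \<cdot> p) (j \<cdot> q) = Ident C X"
      using direct_sum_split[OF d] by metis
    have "is_iso C X X (i \<cdot> p) \<or> is_iso C X X (j \<cdot> q)"
      using X h(9) is_iso_Ident[OF local_object_obj[OF X]] Comp_closed[OF h(3,1)]
        Comp_closed[OF h(4,2)] unfolding local_object_def by metis
    then show ?thesis using main[OF h(1-4,6,7)] main[OF h(2,1,4,3,5,8)] by blast
  qed
  then show ?thesis
    unfolding indecomposable_def using X local_object_obj local_object_not_zero by blast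
qed

end

lemma (in additive_category) direct_sum_exists: "A \<in> Obj C \<Longrightarrow> B \<in> Obj C \<Longrightarrow> \<exists>Y. direct_sum C A B Y"
  using finite_biproducts[of "[A, B]"] by (simp add: direct_sum_def numeral_2_eq_2)

section \<open>Multiplicities of compact objects in coproducts\<close>

text \<open>The closure under isomorphism of the possible summands of a \<open>ks_decomposition\<close>.\<close>

definition compact_local_object :: "('o, 'm) precat \<Rightarrow> 'o \<Rightarrow> bool" where
  "compact_local_object C X \<longleftrightarrow>
     (\<exists>Y. isomorphic C X Y \<and> compact_object C Y \<and> local_ring (end_ring C Y))"

text \<open>The coproduct underlying \<open>lf_direct_sum\<close>: by its universal property, decompositions can be
  reindexed, combined and compared.\<close>

definition lf_coproduct ::
  "('o, 'm) precat \<Rightarrow> 'i set \<Rightarrow> ('i \<Rightarrow> 'o) \<Rightarrow> ('i \<Rightarrow> nat) \<Rightarrow> 'o \<Rightarrow> bool" where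
  "lf_coproduct C I X n M \<longleftrightarrow>
     (\<exists>\<iota>. is_coproduct C (SIGMA i:I. {..<n i}) (\<lambda>(i, k). X i) M \<iota>)"

lemma lf_coproductI:
  "is_coproduct C (SIGMA i:I. {..<n i}) (\<lambda>(i, k). X i) M \<iota> \<Longrightarrow> lf_coproduct C I X n M"
  unfolding lf_coproduct_def by metis

lemma lf_coproduct_if_lf_direct_sum: "lf_direct_sum C I X n M \<Longrightarrow> lf_coproduct C I X n M"
  unfolding lf_direct_sum_def lf_coproduct_def by (elim exE) (rule exI, erule is_biproduct_coproduct)

context preadditive_category
begin

lemma compact_local_object_local: "compact_local_object C X \<Longrightarrow> local_object C X"
  using local_object_if_local_ring local_object_isomorphic isomorphic_iff
  unfolding compact_local_object_def by metis

text \<open>Compactness concerns families indexed by arrows. A family of nonzero objects is reindexed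
  by its injections, which are pairwise distinct.\<close>

lemma compact_finite_sum:
  assumes Y: "compact_object C Y" and P: "is_coproduct C J N P \<iota>"
    and nz: "\<And>j. j \<in> J \<Longrightarrow> \<not> zero_object C (N j)" and f: "f \<in> Hom C Y P"
  obtains F x where "finite F" "F \<subseteq> J" "\<And>j. j \<in> F \<Longrightarrow> x j \<in> Hom C Y (N j)"
    "f = arr_sum Y P (\<lambda>j. \<iota> j \<cdot> x j) F"
proof -
  note oP = coproduct_objs[OF P]
  have Yo: "Y \<in> Obj C" using f Hom_objs by blast
  have inj: "inj_on \<iota> J"
  proof (rule inj_onI, rule ccontr)
    fix j k assume jk: "j \<in> J" "k \<in> J" "\<iota> j = \<iota> k" "j \<noteq> k"
    have "N j = N k" using oP(3)[OF jk(1)] oP(3)[OF jk(2)] jk(3) by (simp add: Hom_def)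
    then have "Ident C (N j) = ZeroArr C (N j) (N j)"
      using canonical_proj(2)[OF P jk(1) jk(1)] canonical_proj(2)[OF P jk(1) jk(2)] jk(3,4) by simp
    then show False using nz[OF jk(1)] zero_object_iff oP(2)[OF jk(1)] by blast
  qed
  define \<sigma> where "\<sigma> = inv_into J \<iota>"
  have \<sigma>: "bij_betw \<sigma> (\<iota> ` J) J"
    unfolding \<sigma>_def using inj by (simp add: bij_betw_inv_into inj_on_imp_bij_betw)
  have \<sigma>J: "\<sigma> k \<in> J" and \<iota>\<sigma>: "\<iota> (\<sigma> k) = k" if "k \<in> \<iota> ` J" for k
    using that unfolding \<sigma>_def by (auto intro: inv_into_into f_inv_into_f)
  let ?N = "\<lambda>k. N (\<sigma> k)" and ?\<kappa> = "\<lambda>k. \<iota> (\<sigma> k) \<cdot> Ident C (N (\<sigma> k))"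
  have \<kappa>: "?\<kappa> k = k" "k \<in> Hom C (?N k) P" if "k \<in> \<iota> ` J" for k
    using that \<iota>\<sigma>[OF that] oP(3)[OF \<sigma>J[OF that]] Comp_Ident by auto
  have c: "is_coproduct C (\<iota> ` J) ?N P ?\<kappa>"
    by (rule coproduct_reindex[OF P \<sigma>]) (use \<sigma>J oP is_iso_Ident in blast)
  have grp: "group (hom_group C Y (?N k))" if "k \<in> \<iota> ` J" for k
    using hom_comm_group[OF Yo oP(2)[OF \<sigma>J[OF that]]] comm_group.axioms(2) by blast
  let ?\<Phi> = "\<lambda>x. gfinprod (hom_group C Y P) (\<lambda>k. ?\<kappa> k \<cdot> x k) (\<iota> ` J)"
  have "?\<Phi> \<in> iso (sum_group (\<iota> ` J) (\<lambda>k. hom_group C Y (?N k))) (hom_group C Y P)"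
    using Y c unfolding compact_object_def by meson
  then have "?\<Phi> ` carrier (sum_group (\<iota> ` J) (\<lambda>k. hom_group C Y (?N k))) = Hom C Y P"
    by (simp add: iso_def bij_betw_def)
  then obtain x where x: "x \<in> carrier (sum_group (\<iota> ` J) (\<lambda>k. hom_group C Y (?N k)))"
    and fx: "f = ?\<Phi> x"
    using f by blast
  have xH: "x k \<in> Hom C Y (?N k)" if "k \<in> \<iota> ` J" for k
    using x that by (auto simp: carrier_sum_group[OF grp] PiE_iff)
  have finx: "finite {k \<in> \<iota> ` J. x k \<noteq> ZeroArr C Y (?N k)}"
    using x by (simp add: carrier_sum_group[OF grp])
  define E where "E = {k \<in> \<iota> ` J. ?\<kappa> k \<cdot> x k \<noteq> ZeroArr C Y P}"
  have EJ: "E \<subseteq> \<iota> ` J" unfolding E_def by blast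
  have "E \<subseteq> {k \<in> \<iota> ` J. x k \<noteq> ZeroArr C Y (?N k)}"
    unfolding E_def using \<kappa> Comp_Zero Yo by auto
  then have finE: "finite E" using finx finite_subset by blast
  have H: "k \<cdot> x k \<in> Hom C Y P" if "k \<in> E" for k
    using that EJ \<kappa>(2) xH Comp_closed by blast
  have "f = arr_sum Y P (\<lambda>k. ?\<kappa> k \<cdot> x k) E"
    using fx finE unfolding gfinprod_def by (simp add: E_def)
  also have "\<dots> = arr_sum Y P (\<lambda>k. k \<cdot> x k) E"
    using EJ \<kappa>(1) H Yo oP(1) by (intro arr_sum_cong) auto
  also have "\<dots> = arr_sum Y P (\<lambda>k. \<iota> (\<sigma> k) \<cdot> x (\<iota> (\<sigma> k))) E"
    using EJ \<iota>\<sigma> H Yo oP(1) by (intro arr_sum_cong) auto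
  also have "\<dots> = arr_sum Y P (\<lambda>j. \<iota> j \<cdot> x (\<iota> j)) (\<sigma> ` E)"
  proof -
    interpret G: comm_group "hom_group C Y P" using hom_comm_group Yo oP(1) by blast
    have "inj_on \<sigma> E" using \<sigma> EJ unfolding bij_betw_def by (blast intro: inj_on_subset)
    moreover have "(\<lambda>j. \<iota> j \<cdot> x (\<iota> j)) \<in> \<sigma> ` E \<rightarrow> Hom C Y P"
      using H \<iota>\<sigma> EJ by auto
    ultimately show ?thesis using G.finprod_reindex[of "\<lambda>j. \<iota> j \<cdot> x (\<iota> j)" \<sigma> E] by simp
  qed
  finally have "f = arr_sum Y P (\<lambda>j. \<iota> j \<cdot> x (\<iota> j)) (\<sigma> ` E)" .
  moreover have "x (\<iota> j) \<in> Hom C Y (N j)" if "j \<in> \<sigma> ` E" for j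
    using that xH EJ \<iota>\<sigma> by auto
  ultimately show ?thesis using that[of "\<sigma> ` E" "\<lambda>j. x (\<iota> j)"] finE EJ \<sigma>J by blast
qed

lemma compact_local_finite_sum:
  assumes X: "compact_local_object C X" and P: "is_coproduct C J N P \<iota>"
    and nz: "\<And>j. j \<in> J \<Longrightarrow> \<not> zero_object C (N j)" and f: "f \<in> Hom C X P"
  obtains F x where "finite F" "F \<subseteq> J" "\<And>j. j \<in> F \<Longrightarrow> x j \<in> Hom C X (N j)"
    "f = arr_sum X P (\<lambda>j. \<iota> j \<cdot> x j) F"
proof -
  note oP = coproduct_objs[OF P]
  obtain Y u v where Y: "compact_object C Y" and u: "u \<in> Hom C X Y" and v: "v \<in> Hom C Y X"
    and vu: "v \<cdot> u = Ident C X"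
    using X unfolding compact_local_object_def isomorphic_def by blast
  obtain F x where F: "finite F" "F \<subseteq> J" and x: "\<And>j. j \<in> F \<Longrightarrow> x j \<in> Hom C Y (N j)"
    and fv: "f \<cdot> v = arr_sum Y P (\<lambda>j. \<iota> j \<cdot> x j) F"
    using compact_finite_sum[OF Y P nz Comp_closed[OF v f]] by blast
  have \<iota>x: "\<iota> j \<cdot> x j \<in> Hom C Y P" and xu: "x j \<cdot> u \<in> Hom C X (N j)" if "j \<in> F" for j
    using that F x oP Comp_closed u by blast+
  have o: "X \<in> Obj C" using u Hom_objs by blast
  have "f = (f \<cdot> v) \<cdot> u" using Comp_assoc[OF u v f] vu Comp_Ident[OF f] by simp
  also have "\<dots> = arr_sum X P (\<lambda>j. (\<iota> j \<cdot> x j) \<cdot> u) F"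
    unfolding fv by (rule arr_sum_Comp[OF F(1) \<iota>x oP(1) u])
  also have "\<dots> = arr_sum X P (\<lambda>j. \<iota> j \<cdot> (x j \<cdot> u)) F"
  proof (rule arr_sum_cong[OF o oP(1)])
    fix j assume j: "j \<in> F"
    show "(\<iota> j \<cdot> x j) \<cdot> u \<in> Hom C X P" using Comp_closed[OF u \<iota>x[OF j]] .
    show "(\<iota> j \<cdot> x j) \<cdot> u = \<iota> j \<cdot> (x j \<cdot> u)"
      using Comp_assoc[OF u x[OF j] oP(3)] F j by blast
  qed
  finally show ?thesis using that[OF F, of "\<lambda>j. x j \<cdot> u"] xu by blast
qed

text \<open>By compactness the arrows \<open>f c\<close> reach only finitely many summands, so the retraction of \<open>M\<close>
  onto \<open>m\<close> copies of \<open>X\<close> is a finite matrix product.\<close>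

lemma retract_multiplicity_le:
  fixes m :: nat
  assumes X: "compact_local_object C X" and M: "is_coproduct C J Y M \<iota>"
    and Y: "\<And>j. j \<in> J \<Longrightarrow> local_object C (Y j)"
    and f: "\<And>c. c < m \<Longrightarrow> f c \<in> Hom C X M" and g: "\<And>a. a < m \<Longrightarrow> g a \<in> Hom C M X"
    and gf: "\<And>a c. a < m \<Longrightarrow> c < m \<Longrightarrow> g a \<cdot> f c = (if a = c then Ident C X else ZeroArr C X X)"
    and fin: "finite {j \<in> J. isomorphic C (Y j) X}"
  shows "m \<le> card {j \<in> J. isomorphic C (Y j) X}"
proof -
  note oM = coproduct_objs[OF M]
  have lX: "local_object C X" using X by (rule compact_local_object_local)
  then have o: "X \<in> Obj C" by (rule local_object_obj)
  have nz: "\<not> zero_object C (Y j)" if "j \<in> J" for j using Y[OF that] local_object_not_zero by blast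
  have "\<exists>E x. finite E \<and> E \<subseteq> J \<and> (\<forall>j\<in>E. x j \<in> Hom C X (Y j)) \<and> f c = arr_sum X M (\<lambda>j. \<iota> j \<cdot> x j) E"
    if "c < m" for c
    using compact_local_finite_sum[OF X M nz f[OF that]] by metis
  then obtain E x where E: "\<And>c. c < m \<Longrightarrow> finite (E c) \<and> E c \<subseteq> J \<and> (\<forall>j\<in>E c. x c j \<in> Hom C X (Y j))
      \<and> f c = arr_sum X M (\<lambda>j. \<iota> j \<cdot> x c j) (E c)"
    by metis
  define F where "F = (\<Union>c<m. E c)"
  define A where "A j c = (if j \<in> E c then x c j else ZeroArr C X (Y j))" for j c
  have F: "finite F" "F \<subseteq> J" using E unfolding F_def by auto
  have A: "A j c \<in> Hom C X (Y j)" if "c < m" "j \<in> F" for j c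
    using that E[of c] F oM(2) Zero_closed[OF o] unfolding A_def by auto
  have \<iota>: "\<iota> j \<in> Hom C (Y j) M" if "j \<in> F" for j using that F oM(3) by blast
  have \<iota>A: "\<iota> j \<cdot> A j c \<in> Hom C X M" if "c < m" "j \<in> F" for j c
    using Comp_closed[OF A[OF that] \<iota>[OF that(2)]] .
  have fA: "f c = arr_sum X M (\<lambda>j. \<iota> j \<cdot> A j c) F" if c: "c < m" for c
  proof -
    have EF: "E c \<subseteq> F" using c unfolding F_def by blast
    have "f c = arr_sum X M (\<lambda>j. \<iota> j \<cdot> x c j) (E c)" using E[OF c] by blast
    also have "\<dots> = arr_sum X M (\<lambda>j. \<iota> j \<cdot> A j c) (E c)"
    proof (rule arr_sum_cong[symmetric, OF o oM(1)])
      show "\<iota> j \<cdot> A j c \<in> Hom C X M" if "j \<in> E c" for j using \<iota>A[OF c] that EF by blast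
    qed (simp add: A_def)
    also have "\<dots> = arr_sum X M (\<lambda>j. \<iota> j \<cdot> A j c) F"
    proof (rule arr_sum_mono_neutral)
      show "\<iota> j \<cdot> A j c = ZeroArr C X M" if "j \<in> F - E c" for j
        using that Comp_Zero[OF \<iota> o] by (simp add: A_def)
    qed (use o oM(1) F(1) EF \<iota>A[OF c] in auto)
    finally show ?thesis .
  qed
  have B: "g a \<cdot> \<iota> j \<in> Hom C (Y j) X" if "a < m" "j \<in> F" for a j
    using Comp_closed[OF \<iota>[OF that(2)] g[OF that(1)]] .
  have prod: "arr_sum X X (\<lambda>j. (g a \<cdot> \<iota> j) \<cdot> A j c) F = (if a = c then Ident C X else ZeroArr C X X)"
    if a: "a < m" and c: "c < m" for a c
  proof -
    have "arr_sum X X (\<lambda>j. (g a \<cdot> \<iota> j) \<cdot> A j c) F = arr_sum X X (\<lambda>j. g a \<cdot> (\<iota> j \<cdot> A j c)) F"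
    proof (rule arr_sum_cong[OF o o])
      fix j assume j: "j \<in> F"
      show "(g a \<cdot> \<iota> j) \<cdot> A j c \<in> Hom C X X" using Comp_closed[OF A[OF c j] B[OF a j]] .
      show "(g a \<cdot> \<iota> j) \<cdot> A j c = g a \<cdot> (\<iota> j \<cdot> A j c)" using Comp_assoc[OF A[OF c j] \<iota>[OF j] g[OF a]] .
    qed
    also have "\<dots> = g a \<cdot> f c"
      unfolding fA[OF c] by (rule Comp_arr_sum[symmetric, OF F(1) o \<iota>A[OF c] g[OF a]])
    finally show ?thesis using gf[OF a c] by simp
  qed
  have "m \<le> card {j \<in> F. isomorphic C (Y j) X}"
  proof (rule local_matrix_rank[OF lX F(1), where B = "\<lambda>a j. g a \<cdot> \<iota> j" and A = A])
  qed (use Y F A B prod in auto)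
  also have "\<dots> \<le> card {j \<in> J. isomorphic C (Y j) X}"
    using F by (intro card_mono[OF fin]) auto
  finally show ?thesis .
qed

text \<open>The injections and canonical projections of the summands in \<open>L\<close> exhibit \<open>card L\<close> copies of
  \<open>X\<close> as a retract of \<open>M\<close>.\<close>

lemma coproduct_multiplicity_le:
  assumes X: "compact_local_object C X"
    and K: "is_coproduct C K Z M \<kappa>" and L: "finite L" "L \<subseteq> K" "\<And>k. k \<in> L \<Longrightarrow> isomorphic C (Z k) X"
    and J: "is_coproduct C J Y M \<iota>" "\<And>j. j \<in> J \<Longrightarrow> local_object C (Y j)"
    and fin: "finite {j \<in> J. isomorphic C (Y j) X}"
  shows "card L \<le> card {j \<in> J. isomorphic C (Y j) X}"
proof -
  obtain e where e: "bij_betw e {..<card L} L"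
    using L(1) ex_bij_betw_nat_finite lessThan_atLeast0 by metis
  have eL: "e a \<in> L" "e a \<in> K" if "a < card L" for a
    using that e L(2) bij_betwE by blast+
  have "\<exists>u v. u \<in> Hom C X (Z k) \<and> v \<in> Hom C (Z k) X \<and> v \<cdot> u = Ident C X" if "k \<in> L" for k
    using L(3)[OF that] unfolding isomorphic_def by blast
  then obtain u v where u: "\<And>k. k \<in> L \<Longrightarrow> u k \<in> Hom C X (Z k)"
    and v: "\<And>k. k \<in> L \<Longrightarrow> v k \<in> Hom C (Z k) X" and vu: "\<And>k. k \<in> L \<Longrightarrow> v k \<cdot> u k = Ident C X"
    by metis
  define p where "p k = canonical_proj C K Z M \<kappa> k" for k
  have \<kappa>: "\<kappa> k \<in> Hom C (Z k) M" if "k \<in> L" for k using that L coproduct_objs(3)[OF K] by blast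
  have p: "p k \<in> Hom C M (Z k)" if "k \<in> L" for k
    using that L canonical_proj(1)[OF K] unfolding p_def by blast
  have p\<kappa>: "p k \<cdot> \<kappa> l = (if l = k then Ident C (Z k) else ZeroArr C (Z l) (Z k))"
    if "k \<in> L" "l \<in> L" for k l
    using that L canonical_proj(2)[OF K, of k l] unfolding p_def by blast
  have comp: "(v k \<cdot> p k) \<cdot> (\<kappa> l \<cdot> u l) = (if l = k then Ident C X else ZeroArr C X X)"
    if k: "k \<in> L" and l: "l \<in> L" for k l
  proof -
    have "(v k \<cdot> p k) \<cdot> (\<kappa> l \<cdot> u l) = v k \<cdot> ((p k \<cdot> \<kappa> l) \<cdot> u l)"
      using u[OF l] v[OF k] p[OF k] \<kappa>[OF l] by (simp add: Hom_def arr_simps)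
    then show ?thesis
      using p\<kappa>[OF k l] vu[OF k] Ident_Comp[OF u[OF k]] Zero_Comp[OF u[OF l]] Comp_Zero[OF v[OF k]]
        Hom_objs[OF v[OF k]] by simp
  qed
  have inj: "e c = e a \<longleftrightarrow> a = c" if "a < card L" "c < card L" for a c
    using that e unfolding bij_betw_def by (auto dest: inj_onD)
  show ?thesis
  proof (rule retract_multiplicity_le[OF X J, where f = "\<lambda>a. \<kappa> (e a) \<cdot> u (e a)"
        and g = "\<lambda>a. v (e a) \<cdot> p (e a)"])
    show "(v (e a) \<cdot> p (e a)) \<cdot> (\<kappa> (e c) \<cdot> u (e c)) = (if a = c then Ident C X else ZeroArr C X X)"
      if "a < card L" "c < card L" for a c
      using comp[OF eL(1)[OF that(1)] eL(1)[OF that(2)]] inj[OF that] by simp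
  qed (use fin eL Comp_closed u v p \<kappa> in blast)+
qed

text \<open>The copies of \<open>X i\<close> in one decomposition of \<open>M\<close> are bounded in number by the copies in the
  other, and conversely.\<close>

lemma lf_coproduct_unique:
  fixes I :: "'i set"
  assumes X: "\<And>i. i \<in> I \<Longrightarrow> compact_local_object C (X i)"
    and inj: "\<And>i j. i \<in> I \<Longrightarrow> j \<in> I \<Longrightarrow> isomorphic C (X i) (X j) \<Longrightarrow> i = j"
    and n: "lf_coproduct C I X n M" and m: "lf_coproduct C I X m M" and i: "i \<in> I"
  shows "n i = m i"
proof -
  have o: "X j \<in> Obj C" if "j \<in> I" for j
    using X[OF that] local_object_obj compact_local_object_local by blast
  have block: "{x \<in> (SIGMA i:I. {..<n i}). isomorphic C (case x of (i, k) \<Rightarrow> X i) (X i)}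
      = {i} \<times> {..<n i}" for n :: "'i \<Rightarrow> nat"
    using i inj isomorphic_refl[OF o[OF i]] by auto
  have le: "n i \<le> m i" if n: "lf_coproduct C I X n M" and m: "lf_coproduct C I X m M" for n m
  proof -
    obtain \<kappa> where \<kappa>: "is_coproduct C (SIGMA i:I. {..<n i}) (\<lambda>(i, k). X i) M \<kappa>"
      using n unfolding lf_coproduct_def by (elim exE)
    obtain \<iota> where \<iota>: "is_coproduct C (SIGMA i:I. {..<m i}) (\<lambda>(i, k). X i) M \<iota>"
      using m unfolding lf_coproduct_def by (elim exE)
    have "card ({i} \<times> {..<n i}) \<le> card {x \<in> (SIGMA i:I. {..<m i}).
        isomorphic C (case x of (i, k) \<Rightarrow> X i) (X i)}"
    proof (rule coproduct_multiplicity_le[OF X[OF i] \<kappa> _ _ _ \<iota>])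
      show "isomorphic C (case k of (i, k) \<Rightarrow> X i) (X i)" if "k \<in> {i} \<times> {..<n i}" for k
        using that isomorphic_refl[OF o[OF i]] by auto
      show "local_object C (case j of (i, k) \<Rightarrow> X i)" if "j \<in> (SIGMA i:I. {..<m i})" for j
        using that X compact_local_object_local by auto
    qed (use i in \<open>auto simp: block\<close>)
    then show ?thesis by (simp add: block)
  qed
  show ?thesis using le[OF n m] le[OF m n] by simp
qed

end

section \<open>Decompositions into the given indecomposable objects\<close>

context category
begin

lemma lf_coproduct_cong:
  assumes "\<And>i. i \<in> I \<Longrightarrow> n i = m i"
  shows "lf_coproduct C I X n M \<longleftrightarrow> lf_coproduct C I X m M"
proof -
  have "(SIGMA i:I. {..<n i}) = (SIGMA i:I. {..<m i})" using assms by auto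
  then show ?thesis unfolding lf_coproduct_def by simp
qed

lemma lf_coproduct_obj: "lf_coproduct C I X n M \<Longrightarrow> M \<in> Obj C"
  unfolding lf_coproduct_def by (elim exE) (rule coproduct_objs(1))

lemma lf_coproduct_same_isomorphic:
  "lf_coproduct C I X n M \<Longrightarrow> lf_coproduct C I X n N \<Longrightarrow> isomorphic C M N"
  unfolding lf_coproduct_def by (elim exE) (rule coproduct_unique)

lemma lf_coproduct_isomorphic:
  assumes "lf_coproduct C I X n M" "isomorphic C M N"
  shows "lf_coproduct C I X n N"
proof -
  obtain \<iota> where \<iota>: "is_coproduct C (SIGMA i:I. {..<n i}) (\<lambda>(i, k). X i) M \<iota>"
    using assms(1) unfolding lf_coproduct_def by (elim exE)
  obtain u where "is_iso C M N u" using assms(2) isomorphic_iff by metis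
  from coproduct_isomorphic[OF \<iota> this] show ?thesis by (rule lf_coproductI)
qed

lemma lf_coproduct_single:
  assumes i: "i \<in> I" and Xi: "X i \<in> Obj C"
  shows "lf_coproduct C I X (\<lambda>j. if j = i then 1 else 0) (X i)"
proof -
  have S: "(SIGMA j:I. {..<if j = i then 1 else 0}) = {(i, 0::nat)}"
    using i by (auto split: if_splits)
  have ex1: "\<exists>!h. h \<in> Hom C (X i) Z \<and> h \<cdot> Ident C (X i) = g" if "g \<in> Hom C (X i) Z" for Z g
    using that Comp_Ident by (intro ex1I[of _ g]) auto
  have "is_coproduct C {(i, 0::nat)} (\<lambda>(i, k). X i) (X i) (\<lambda>_. Ident C (X i))"
    unfolding is_coproduct_def using Xi Ident_closed ex1 by simp
  then show ?thesis by (intro lf_coproductI) (simp only: S)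
qed

lemma lf_coproduct_direct_sum:
  assumes Y: "direct_sum C A B Y" and A: "lf_coproduct C I X n A" and B: "lf_coproduct C I X m B"
  shows "lf_coproduct C I X (\<lambda>i. n i + m i) Y"
proof -
  let ?J = "SIGMA i:I. {..<n i}" and ?K = "SIGMA i:I. {..<m i}" and ?L = "SIGMA i:I. {..<n i + m i}"
    and ?X = "\<lambda>(i, k::nat). X i"
  obtain \<kappa> where "is_biproduct C {..<2} ((!) [A, B]) Y \<kappa>"
    using Y unfolding direct_sum_def by (elim exE)
  then have \<kappa>: "is_coproduct C {..<2} ((!) [A, B]) Y \<kappa>" by (rule is_biproduct_coproduct)
  obtain \<iota> where \<iota>: "is_coproduct C ?J ?X A \<iota>" using A unfolding lf_coproduct_def by (elim exE)
  obtain \<mu> where \<mu>: "is_coproduct C ?K ?X B \<mu>" using B unfolding lf_coproduct_def by (elim exE)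
  note sum = coproduct_sum[OF \<kappa> \<iota> \<mu>]
  \<comment> \<open>Among the \<open>n i + m i\<close> copies of \<open>X i\<close>, those from \<open>A\<close> come first.\<close>
  define \<sigma> where "\<sigma> = (\<lambda>(i, k). if k < n i then Inl (i, k) else Inr (i, k - n i))"
  have \<sigma>: "bij_betw \<sigma> ?L (?J <+> ?K)"
    by (rule bij_betwI[of _ _ _ "case_sum (\<lambda>(i, k). (i, k)) (\<lambda>(i, k). (i, n i + k))"])
      (auto simp: \<sigma>_def)
  have o: "X i \<in> Obj C" if "i \<in> I" "0 < n i + m i" for i
    using that coproduct_objs(2)[OF \<iota>, of "(i, 0)"] coproduct_objs(2)[OF \<mu>, of "(i, 0)"] by auto
  have "is_coproduct C ?L ?X Y
      (\<lambda>x. case_sum (\<lambda>j. \<kappa> 0 \<cdot> \<iota> j) (\<lambda>k. \<kappa> 1 \<cdot> \<mu> k) (\<sigma> x) \<cdot> Ident C (?X x))"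
  proof (rule coproduct_reindex[OF sum \<sigma>])
    fix x assume x: "x \<in> ?L"
    obtain i k where "x = (i, k)" "i \<in> I" "k < n i + m i" using x by blast
    then have "?X x \<in> Obj C" using o[of i] by (cases "n i + m i") simp_all
    moreover have "case_sum ?X ?X (\<sigma> x) = ?X x" by (auto simp: \<sigma>_def split: prod.splits)
    ultimately show "is_iso C (?X x) (case_sum ?X ?X (\<sigma> x)) (Ident C (?X x))"
      using is_iso_Ident by simp
  qed
  then show ?thesis by (rule lf_coproductI)
qed

end

locale krull_schmidt_basis = locally_krull_schmidt C for C :: "('o, 'm) precat" (structure) +
  fixes I :: "'i set" and X :: "'i \<Rightarrow> 'o"
  assumes full: "full_indecomposables C I X" and admits: "admits_lf_direct_sums C I X"
begin

lemma X_indecomposable: "i \<in> I \<Longrightarrow> indecomposable C (X i)"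
  using full by (simp add: full_indecomposables_def)

lemma X_obj: "i \<in> I \<Longrightarrow> X i \<in> Obj C"
  using X_indecomposable by (auto simp: indecomposable_def)

lemma X_inj: "i \<in> I \<Longrightarrow> j \<in> I \<Longrightarrow> isomorphic C (X i) (X j) \<Longrightarrow> i = j"
  using full by (simp add: full_indecomposables_def)

lemma lf_coproduct_exists: "\<exists>M. lf_coproduct C I X n M"
  using admits unfolding admits_lf_direct_sums_def by (metis lf_coproduct_if_lf_direct_sum)

text \<open>A summand with local endomorphism ring is indecomposable and hence isomorphic to exactly one
  \<open>X i\<close>; since the summands are pairwise non-isomorphic, different summands belong to different
  indices. Replacing each summand by its \<open>X i\<close> turns the decomposition into one over \<open>I\<close>.\<close>

lemma lf_coproduct_if_ks_decomposition:
  assumes "ks_decomposition C M S n"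
  shows "lf_coproduct C I X (\<lambda>i. \<Sum>Y | Y \<in> S \<and> isomorphic C Y (X i). n Y) M"
    (is "lf_coproduct C I X ?n M")
proof -
  have S_ind: "indecomposable C Y" if "Y \<in> S" for Y
  proof -
    have "compact_object C Y" "local_ring (end_ring C Y)"
      using assms that by (auto simp: ks_decomposition_def)
    then show ?thesis
      using local_object_indecomposable[OF local_object_if_local_ring]
      unfolding compact_object_def by blast
  qed
  have S_inj: "Y = Z" if "Y \<in> S" "Z \<in> S" "isomorphic C Y Z" for Y Z
    using assms that by (auto simp: ks_decomposition_def)
  have "lf_coproduct C S (\<lambda>Y. Y) n M"
    using assms lf_coproduct_if_lf_direct_sum by (auto simp: ks_decomposition_def)
  then obtain \<iota> where \<iota>: "is_coproduct C (SIGMA Y:S. {..<n Y}) (\<lambda>(Y, k). Y) M \<iota>"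
    unfolding lf_coproduct_def by (elim exE)
  have "\<exists>i. i \<in> I \<and> isomorphic C Y (X i)" if "Y \<in> S" for Y
    using full S_ind[OF that] unfolding full_indecomposables_def by blast
  then obtain \<phi> where \<phi>: "\<And>Y. Y \<in> S \<Longrightarrow> \<phi> Y \<in> I \<and> isomorphic C Y (X (\<phi> Y))" by metis
  have \<phi>_eq: "i = \<phi> Y" if "Y \<in> S" "i \<in> I" "isomorphic C Y (X i)" for Y i
    using X_inj[OF that(2), of "\<phi> Y"] \<phi>[OF that(1)] that isomorphic_sym isomorphic_trans by metis
  have n_\<phi>: "?n (\<phi> Y) = n Y" if "Y \<in> S" for Y
  proof -
    have "{Z. Z \<in> S \<and> isomorphic C Z (X (\<phi> Y))} = {Y}"
      using that \<phi>[OF that] S_inj isomorphic_sym isomorphic_trans by blast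
    then show ?thesis by simp
  qed
  have n_pos: "\<exists>Y\<in>S. i = \<phi> Y" if "i \<in> I" "0 < ?n i" for i
  proof -
    have "{Z. Z \<in> S \<and> isomorphic C Z (X i)} \<noteq> {}" using that by force
    then show ?thesis using \<phi>_eq that by blast
  qed
  have \<phi>_inj: "Y = Z" if "Y \<in> S" "Z \<in> S" "\<phi> Y = \<phi> Z" for Y Z
    using S_inj[OF that(1,2)] \<phi>[OF that(1)] \<phi>[OF that(2)] that(3) isomorphic_sym isomorphic_trans by metis
  \<comment> \<open>Off the image of \<open>\<phi>\<close> the multiplicity is zero, so \<open>\<psi>\<close> may be arbitrary there.\<close>
  define \<psi> where "\<psi> = inv_into S \<phi>"
  have \<psi>\<phi>: "\<psi> (\<phi> Y) = Y" if "Y \<in> S" for Y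
    unfolding \<psi>_def using \<phi>_inj that by (intro inv_into_f_f inj_onI)
  have \<sigma>: "bij_betw (\<lambda>(i, k). (\<psi> i, k)) (SIGMA i:I. {..<?n i}) (SIGMA Y:S. {..<n Y})"
  proof (rule bij_betwI[of _ _ _ "\<lambda>(Y, k). (\<phi> Y, k)"])
    show "(\<lambda>(i, k). (\<psi> i, k)) \<in> (SIGMA i:I. {..<?n i}) \<rightarrow> (SIGMA Y:S. {..<n Y})"
    proof (rule funcsetI)
      fix x assume "x \<in> (SIGMA i:I. {..<?n i})"
      then obtain i k where x: "x = (i, k)" "i \<in> I" "k < ?n i" by blast
      then obtain Y where "Y \<in> S" "i = \<phi> Y" using n_pos[of i] by force
      then show "(case x of (i, k) \<Rightarrow> (\<psi> i, k)) \<in> (SIGMA Y:S. {..<n Y})"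
        using x \<psi>\<phi> n_\<phi> by auto
    qed
    show "(case (case x of (i, k) \<Rightarrow> (\<psi> i, k)) of (Y, k) \<Rightarrow> (\<phi> Y, k)) = x"
      if x: "x \<in> (SIGMA i:I. {..<?n i})" for x
    proof -
      obtain i k where x: "x = (i, k)" "i \<in> I" "k < ?n i" using x by blast
      then obtain Y where "Y \<in> S" "i = \<phi> Y" using n_pos[of i] by force
      then show ?thesis using x \<psi>\<phi> by auto
    qed
  qed (use \<phi> n_\<phi> \<psi>\<phi> in auto)
  have "\<exists>u. is_iso C (X i) (\<psi> i) u" if "i \<in> I" "0 < ?n i" for i
  proof -
    from n_pos[OF that] obtain Y where "Y \<in> S" "i = \<phi> Y" by blast
    then have "isomorphic C (X i) (\<psi> i)" using \<phi> \<psi>\<phi> isomorphic_sym by metis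
    then show ?thesis using isomorphic_iff by metis
  qed
  then obtain u where u: "\<And>i. i \<in> I \<Longrightarrow> 0 < ?n i \<Longrightarrow> is_iso C (X i) (\<psi> i) (u i)" by metis
  have "is_coproduct C (SIGMA i:I. {..<?n i}) (\<lambda>(i, k). X i) M
      (\<lambda>x. \<iota> (case x of (i, k) \<Rightarrow> (\<psi> i, k)) \<cdot> u (fst x))"
    by (rule coproduct_reindex[OF \<iota> \<sigma>]) (use u in auto)
  then show ?thesis by (rule lf_coproductI)
qed

text \<open>If \<open>X i\<^sub>0\<close> occurs in a decomposition of \<open>X i\<close>, then the direct sum \<open>R\<close> of the remaining summands
  exists, because locally finite direct sums of indecomposables do; so \<open>X i \<cong> X i\<^sub>0 \<oplus> R\<close> without
  splitting any idempotent, and \<open>R = 0\<close> by indecomposability. Thus \<open>X i \<cong> X i\<^sub>0\<close>, and \<open>X i\<^sub>0\<close> is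
  isomorphic to a compact object with local endomorphism ring.\<close>

lemma X_compact_local:
  assumes i: "i \<in> I"
  shows "compact_local_object C (X i)"
proof -
  obtain S n where S: "ks_decomposition C (X i) S n"
    using ks_decomposition_exists[OF X_obj[OF i]] by blast
  define n' where "n' j = (\<Sum>Y | Y \<in> S \<and> isomorphic C Y (X j). n Y)" for j
  have n': "lf_coproduct C I X n' (X i)"
    using lf_coproduct_if_ks_decomposition[OF S] unfolding n'_def .
  then obtain \<iota> where \<iota>: "is_coproduct C (SIGMA i:I. {..<n' i}) (\<lambda>(i, k). X i) (X i) \<iota>"
    unfolding lf_coproduct_def by (elim exE)
  have nz: "\<not> zero_object C (X j)" if "j \<in> I" for j
    using X_indecomposable[OF that] by (simp add: indecomposable_def)
  have "\<exists>i0\<in>I. 0 < n' i0"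
  proof (rule ccontr)
    assume "\<not> ?thesis"
    then have e: "(SIGMA i:I. {..<n' i}) = {}" by auto
    have "Ident C (X i) = ZeroArr C (X i) (X i)"
      by (rule coproduct_ext[OF \<iota>[unfolded e], where Z = "X i"])
        (use X_obj[OF i] Ident_closed Zero_closed in auto)
    then show False using nz[OF i] zero_object_iff X_obj[OF i] by blast
  qed
  then obtain i0 where i0: "i0 \<in> I" "0 < n' i0" by blast
  have "{Y. Y \<in> S \<and> isomorphic C Y (X i0)} \<noteq> {}"
    using i0(2) unfolding n'_def by force
  then obtain Y where Y: "Y \<in> S" "isomorphic C Y (X i0)" by blast
  obtain R where R: "lf_coproduct C I X (n'(i0 := n' i0 - 1)) R"
    using lf_coproduct_exists by blast
  obtain Q where Q: "direct_sum C (X i0) R Q"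
    using direct_sum_exists[OF X_obj[OF i0(1)] lf_coproduct_obj[OF R]] by blast
  have "lf_coproduct C I X (\<lambda>j. (if j = i0 then 1 else 0) + (n'(i0 := n' i0 - 1)) j) Q"
    by (rule lf_coproduct_direct_sum[OF Q lf_coproduct_single[where X = X, OF i0(1) X_obj[OF i0(1)]] R])
  also have "(\<lambda>j. (if j = i0 then 1 else 0) + (n'(i0 := n' i0 - 1)) j) = n'"
    using i0(2) by auto
  finally have "isomorphic C Q (X i)" using n' by (rule lf_coproduct_same_isomorphic)
  then have d: "direct_sum C (X i0) R (X i)" by (rule direct_sum_isomorphic[OF Q])
  then have "zero_object C R"
    using X_indecomposable[OF i] nz[OF i0(1)] unfolding indecomposable_def by blast
  then have "isomorphic C (X i0) (X i)" by (rule direct_sum_zero_right[OF d])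
  then have "isomorphic C (X i) Y" using Y(2) isomorphic_sym isomorphic_trans by metis
  moreover have "compact_object C Y" "local_ring (end_ring C Y)"
    using S Y(1) by (auto simp: ks_decomposition_def)
  ultimately show ?thesis unfolding compact_local_object_def by blast
qed

abbreviation mult :: "'i \<Rightarrow> 'o \<Rightarrow> nat" where
  "mult i M \<equiv> multiplicity_in C (X i) M"

lemma mult_eq:
  assumes "lf_coproduct C I X n M" "i \<in> I"
  shows "mult i M = n i"
proof -
  have eq: "(\<Sum>Y | Y \<in> S \<and> isomorphic C Y (X i). m Y) = n i" if "ks_decomposition C M S m" for S m
    using lf_coproduct_unique[OF X_compact_local X_inj lf_coproduct_if_ks_decomposition[OF that]
      assms(1) assms(2)] .
  obtain S m where S: "ks_decomposition C M S m"
    using ks_decomposition_exists lf_coproduct_obj[OF assms(1)] by blast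
  show ?thesis
    unfolding multiplicity_in_def
  proof (rule the_equality)
    show "\<exists>S m. ks_decomposition C M S m \<and> n i = (\<Sum>Y | Y \<in> S \<and> isomorphic C Y (X i). m Y)"
      by (intro exI conjI, rule S, rule eq[OF S, symmetric])
    fix l assume "\<exists>S m. ks_decomposition C M S m \<and> l = (\<Sum>Y | Y \<in> S \<and> isomorphic C Y (X i). m Y)"
    then show "l = n i" by (elim exE conjE) (simp only: eq)
  qed
qed

lemma lf_coproduct_mult:
  assumes "M \<in> Obj C"
  shows "lf_coproduct C I X (\<lambda>i. mult i M) M"
proof -
  obtain S m where "ks_decomposition C M S m" using ks_decomposition_exists assms by blast
  from lf_coproduct_if_ks_decomposition[OF this]
  have "lf_coproduct C I X (\<lambda>i. \<Sum>Y | Y \<in> S \<and> isomorphic C Y (X i). m Y) M" .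
  from lf_coproduct_cong[OF mult_eq[OF this]] this show ?thesis by (rule iffD2)
qed

lemma mult_direct_sum:
  assumes "direct_sum C A B Y" "i \<in> I"
  shows "mult i Y = mult i A + mult i B"
proof -
  have o: "A \<in> Obj C" "B \<in> Obj C" using direct_sum_split[OF assms(1)] Hom_objs by metis+
  show ?thesis
    by (rule mult_eq[OF lf_coproduct_direct_sum[OF assms(1) lf_coproduct_mult[OF o(1)]
        lf_coproduct_mult[OF o(2)]] assms(2)])
qed

lemma isomorphic_iff_mult:
  assumes M: "M \<in> Obj C" and N: "N \<in> Obj C"
  shows "isomorphic C M N \<longleftrightarrow> (\<forall>i\<in>I. mult i M = mult i N)"
proof
  assume "isomorphic C M N"
  from mult_eq[OF lf_coproduct_isomorphic[OF lf_coproduct_mult[OF M] this]]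
  show "\<forall>i\<in>I. mult i M = mult i N" by simp
next
  assume eq: "\<forall>i\<in>I. mult i M = mult i N"
  have "lf_coproduct C I X (\<lambda>i. mult i N) M"
    by (rule iffD1[OF lf_coproduct_cong lf_coproduct_mult[OF M]]) (use eq in blast)
  then show "isomorphic C M N"
    using lf_coproduct_mult[OF N] by (rule lf_coproduct_same_isomorphic)
qed

lemma mult_realised: "\<exists>M\<in>Obj C. \<forall>i\<in>I. mult i M = n i"
  using lf_coproduct_exists[of n] lf_coproduct_obj mult_eq by metis

lemma mult_X: "i \<in> I \<Longrightarrow> j \<in> I \<Longrightarrow> mult j (X i) = (if j = i then 1 else 0)"
  using mult_eq[OF lf_coproduct_single[where X = X, OF _ X_obj]] by simp

end

section \<open>The split Grothendieck group\<close>

abbreviation (input) int_product :: "'i set \<Rightarrow> ('i \<Rightarrow> int) monoid" where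
  "int_product I \<equiv> product_group I (\<lambda>_. integer_group)"

lemma comm_group_product_integer: "comm_group (int_product I)"
proof (rule group.group_comm_groupI)
  fix x y :: "'a \<Rightarrow> int"
  show "x \<otimes>\<^bsub>int_product I\<^esub> y = y \<otimes>\<^bsub>int_product I\<^esub> x"
    by (simp add: add.commute)
qed simp

context category
begin

lemma iso_rel_class: "A \<in> Obj C \<Longrightarrow> iso_rel C `` {A} \<in> Obj C // iso_rel C"
  by (rule quotientI)

lemma iso_rel_class_eq:
  assumes "isomorphic C A B"
  shows "iso_rel C `` {A} = iso_rel C `` {B}"
  using assms isomorphic_sym isomorphic_trans unfolding iso_rel_def by blast

lemma obj_gen_closed: "A \<in> Obj C \<Longrightarrow> obj_gen C A \<in> carrier (iso_free_group C)"
  unfolding obj_gen_def using iso_rel_class by simp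

lemma obj_gen_isomorphic: "isomorphic C A B \<Longrightarrow> obj_gen C A = obj_gen C B"
  unfolding obj_gen_def using iso_rel_class_eq by simp

end

context preadditive_category
begin

lemma direct_sum_objs: "direct_sum C A B Y \<Longrightarrow> A \<in> Obj C \<and> B \<in> Obj C \<and> Y \<in> Obj C"
  by (elim direct_sum_split) (use Hom_objs in blast)

lemma split_relation_closed:
  "direct_sum C A B Y \<Longrightarrow> obj_gen C Y - (obj_gen C A + obj_gen C B) \<in> carrier (iso_free_group C)"
proof -
  assume "direct_sum C A B Y"
  then have o: "obj_gen C A \<in> carrier (iso_free_group C)"
    "obj_gen C B \<in> carrier (iso_free_group C)" "obj_gen C Y \<in> carrier (iso_free_group C)"
    using direct_sum_objs obj_gen_closed by blast+
  have "Poly_Mapping.keys (obj_gen C Y - (obj_gen C A + obj_gen C B)) \<subseteq>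
      Poly_Mapping.keys (obj_gen C Y) \<union> (Poly_Mapping.keys (obj_gen C A) \<union> Poly_Mapping.keys (obj_gen C B))"
    using keys_diff[of "obj_gen C Y" "obj_gen C A + obj_gen C B"]
      keys_add[of "obj_gen C A" "obj_gen C B"]
    by blast
  then show ?thesis using o by auto
qed

lemma split_relations_subgroup: "subgroup (split_relations C) (iso_free_group C)"
  unfolding split_relations_def
  by (rule group.generate_is_subgroup)
    (auto intro: split_relation_closed simp del: carrier_free_Abelian_group_iff)

lemma split_relations_carrier: "x \<in> split_relations C \<Longrightarrow> x \<in> carrier (iso_free_group C)"
  using subgroup.mem_carrier[OF split_relations_subgroup] .

lemma split_relations_plus:
  "x \<in> split_relations C \<Longrightarrow> y \<in> split_relations C \<Longrightarrow> x + y \<in> split_relations C"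
  using subgroup.m_closed[OF split_relations_subgroup] by simp

lemma split_relations_uminus: "x \<in> split_relations C \<Longrightarrow> - x \<in> split_relations C"
  using subgroup.m_inv_closed[OF split_relations_subgroup, of x] split_relations_carrier[of x] by simp

lemma split_relations_minus:
  "x \<in> split_relations C \<Longrightarrow> y \<in> split_relations C \<Longrightarrow> x - y \<in> split_relations C"
  using split_relations_plus[OF _ split_relations_uminus, of x y] by simp

lemma split_relations_direct_sum:
  "direct_sum C A B Y \<Longrightarrow> obj_gen C Y - (obj_gen C A + obj_gen C B) \<in> split_relations C"
  unfolding split_relations_def by (rule generate.incl) blast

lemma K0_comm_group: "comm_group (K0_split C)"
  unfolding K0_split_def
  by (rule comm_group.abelian_FactGroup[OF abelian_free_Abelian_group split_relations_subgroup])

lemma K0_class_closed: "A \<in> Obj C \<Longrightarrow> K0_class C A \<in> carrier (K0_split C)"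
  unfolding K0_split_def K0_class_def carrier_FactGroup using obj_gen_closed by blast

end

context additive_category
begin

text \<open>Differences of classes of objects contain the generators, as \<open>[A] = [A \<oplus> A] - [A]\<close>, and form a
  subgroup because direct sums exist.\<close>

lemma difference_of_objects:
  assumes "x \<in> carrier (iso_free_group C)"
  shows "\<exists>A\<in>Obj C. \<exists>B\<in>Obj C. x - (obj_gen C A - obj_gen C B) \<in> split_relations C"
proof (rule free_Abelian_group_induct[where S = "Obj C // iso_rel C" and x = x])
  show "Poly_Mapping.keys x \<subseteq> Obj C // iso_rel C" using assms by simp
  obtain P \<iota> where "is_biproduct C {..<length []} ((!) []) P \<iota>"
    using finite_biproducts[of "[]"] by auto
  from coproduct_objs(1)[OF is_biproduct_coproduct[OF this]] have "P \<in> Obj C" .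
  moreover have "0 \<in> split_relations C" using subgroup.one_closed[OF split_relations_subgroup] by simp
  ultimately show "\<exists>A\<in>Obj C. \<exists>B\<in>Obj C. 0 - (obj_gen C A - obj_gen C B) \<in> split_relations C"
    by (intro bexI[of _ P]) auto
next
  fix x y
  assume "\<exists>A\<in>Obj C. \<exists>B\<in>Obj C. x - (obj_gen C A - obj_gen C B) \<in> split_relations C"
    and "\<exists>A\<in>Obj C. \<exists>B\<in>Obj C. y - (obj_gen C A - obj_gen C B) \<in> split_relations C"
  then obtain A B A' B' where o: "A \<in> Obj C" "B \<in> Obj C" "A' \<in> Obj C" "B' \<in> Obj C"
    and x: "x - (obj_gen C A - obj_gen C B) \<in> split_relations C"
    and y: "y - (obj_gen C A' - obj_gen C B') \<in> split_relations C"
    by blast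
  obtain D where D: "direct_sum C A B' D" using direct_sum_exists o by blast
  obtain E where E: "direct_sum C B A' E" using direct_sum_exists o by blast
  \<comment> \<open>\<open>([A] - [B]) - ([A'] - [B']) = [A \<oplus> B'] - [B \<oplus> A']\<close>\<close>
  have "(x - y) - (obj_gen C D - obj_gen C E)
      = ((x - (obj_gen C A - obj_gen C B)) - (y - (obj_gen C A' - obj_gen C B')))
        - (obj_gen C D - (obj_gen C A + obj_gen C B')) + (obj_gen C E - (obj_gen C B + obj_gen C A'))"
    by (simp add: algebra_simps)
  also have "\<dots> \<in> split_relations C"
    by (intro split_relations_plus split_relations_minus x y split_relations_direct_sum D E)
  finally show "\<exists>A\<in>Obj C. \<exists>B\<in>Obj C. (x - y) - (obj_gen C A - obj_gen C B) \<in> split_relations C"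
    using direct_sum_objs[OF D] direct_sum_objs[OF E] by blast
next
  fix c assume "c \<in> Obj C // iso_rel C"
  then obtain A where A: "A \<in> Obj C" "c = iso_rel C `` {A}" by (rule quotientE)
  obtain D where D: "direct_sum C A A D" using direct_sum_exists A by blast
  have "frag_of c - (obj_gen C D - obj_gen C A) = - (obj_gen C D - (obj_gen C A + obj_gen C A))"
    unfolding A(2) obj_gen_def by (simp add: algebra_simps)
  also have "\<dots> \<in> split_relations C" by (rule split_relations_uminus[OF split_relations_direct_sum[OF D]])
  finally show "\<exists>A\<in>Obj C. \<exists>B\<in>Obj C. frag_of c - (obj_gen C A - obj_gen C B) \<in> split_relations C"
    using A direct_sum_objs[OF D] by blast
qed

end

context krull_schmidt_basis
begin

text \<open>The homomorphism is defined on isomorphism classes by choosing representatives; multiplicities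
  do not depend on the choice.\<close>

lemma multiplicity_hom:
  obtains h where "h \<in> hom (iso_free_group C) (int_product I)"
    "\<And>A. A \<in> Obj C \<Longrightarrow> h (obj_gen C A) = (\<lambda>i\<in>I. int (mult i A))"
proof -
  interpret Z: comm_group "int_product I" by (rule comm_group_product_integer)
  let ?f = "\<lambda>c. \<lambda>i\<in>I. int (mult i (SOME A. A \<in> c))"
  have "?f ` (Obj C // iso_rel C) \<subseteq> carrier (int_product I)" by auto
  then obtain h where h: "h \<in> hom (iso_free_group C) (int_product I)"
    and hf: "\<And>c. c \<in> Obj C // iso_rel C \<Longrightarrow> h (frag_of c) = ?f c"
    using Z.free_Abelian_group_universal by metis
  have "h (obj_gen C A) = (\<lambda>i\<in>I. int (mult i A))" if A: "A \<in> Obj C" for A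
  proof -
    have "A \<in> iso_rel C `` {A}" using isomorphic_refl[OF A] by (simp add: iso_rel_def)
    then have "(SOME B. B \<in> iso_rel C `` {A}) \<in> iso_rel C `` {A}" by (rule someI)
    then have i: "isomorphic C A (SOME B. B \<in> iso_rel C `` {A})" by (simp add: iso_rel_def)
    then have "(SOME B. B \<in> iso_rel C `` {A}) \<in> Obj C" using isomorphic_iff by metis
    with i have "\<forall>j\<in>I. mult j A = mult j (SOME B. B \<in> iso_rel C `` {A})"
      using isomorphic_iff_mult[OF A] by blast
    then show ?thesis
      unfolding obj_gen_def hf[OF iso_rel_class[OF A]] by (intro restrict_ext) simp
  qed
  then show ?thesis using that h by blast
qed

text \<open>The homomorphism of multiplicities is onto, since a family of integers is the difference of its
  positive and its negative part and both are realised by objects. An element of its kernel is,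
  modulo the split relations, a difference \<open>[A] - [B]\<close> of objects with equal multiplicities; these
  are isomorphic, so the difference vanishes.\<close>

lemma K0_iso:
  obtains \<Phi> where "\<Phi> \<in> iso (K0_split C) (int_product I)"
    "\<And>A. A \<in> Obj C \<Longrightarrow> \<Phi> (K0_class C A) = (\<lambda>i\<in>I. int (mult i A))"
proof -
  obtain h where h: "h \<in> hom (iso_free_group C) (int_product I)"
    and hA: "\<And>A. A \<in> Obj C \<Longrightarrow> h (obj_gen C A) = (\<lambda>i\<in>I. int (mult i A))"
    using multiplicity_hom by blast
  interpret F: comm_group "iso_free_group C" by (rule abelian_free_Abelian_group)
  interpret Z: comm_group "int_product I" by (rule comm_group_product_integer)
  interpret h: group_hom "iso_free_group C" "int_product I" h using h by unfold_locales
  have h_plus: "h (x + y) = (\<lambda>i\<in>I. h x i + h y i)"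
    if "x \<in> carrier (iso_free_group C)" "y \<in> carrier (iso_free_group C)" for x y
    using h.hom_mult[OF that] by simp
  have h_minus: "h (x - y) = (\<lambda>i\<in>I. h x i - h y i)"
    if x: "x \<in> carrier (iso_free_group C)" and y: "y \<in> carrier (iso_free_group C)" for x y
  proof -
    have y': "- y \<in> carrier (iso_free_group C)" using y by simp
    have "h (- y) = (\<lambda>i\<in>I. - h y i)"
      using h.hom_inv[OF y] y h.hom_closed[OF y] by simp
    then show ?thesis using h_plus[OF x y'] by (auto intro!: restrict_ext)
  qed
  have plus_closed: "x + y \<in> carrier (iso_free_group C)"
    if "x \<in> carrier (iso_free_group C)" "y \<in> carrier (iso_free_group C)" for x y
    using F.m_closed[OF that] by simp
  have minus_closed: "x - y \<in> carrier (iso_free_group C)"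
    if "x \<in> carrier (iso_free_group C)" "y \<in> carrier (iso_free_group C)" for x y
    using keys_diff[of x y] that by auto
  have ker: "kernel (iso_free_group C) (int_product I) h = split_relations C"
  proof
    show "split_relations C \<subseteq> kernel (iso_free_group C) (int_product I) h"
      unfolding split_relations_def
    proof (rule F.generate_subgroup_incl[OF _ h.subgroup_kernel], rule subsetI)
      fix x assume "x \<in> {obj_gen C Y - (obj_gen C A + obj_gen C B) |A Y B. direct_sum C A B Y}"
      then obtain A B Y where x: "x = obj_gen C Y - (obj_gen C A + obj_gen C B)"
        and d: "direct_sum C A B Y" by blast
      have o: "A \<in> Obj C" "B \<in> Obj C" "Y \<in> Obj C" using direct_sum_objs[OF d] by auto
      note c = obj_gen_closed[OF o(1)] obj_gen_closed[OF o(2)] obj_gen_closed[OF o(3)]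
      have "h x = (\<lambda>i\<in>I. 0)"
        unfolding x h_minus[OF c(3) plus_closed[OF c(1,2)]] h_plus[OF c(1,2)] hA[OF o(1)] hA[OF o(2)]
          hA[OF o(3)]
        using mult_direct_sum[OF d] by (intro restrict_ext) simp
      then show "x \<in> kernel (iso_free_group C) (int_product I) h"
        using split_relation_closed[OF d] unfolding kernel_def x by simp
    qed
    show "kernel (iso_free_group C) (int_product I) h \<subseteq> split_relations C"
    proof
      fix x assume "x \<in> kernel (iso_free_group C) (int_product I) h"
      then have x: "x \<in> carrier (iso_free_group C)" "h x = (\<lambda>i\<in>I. 0)" by (auto simp: kernel_def)
      obtain A B where AB: "A \<in> Obj C" "B \<in> Obj C"
        and d: "x - (obj_gen C A - obj_gen C B) \<in> split_relations C"
        using difference_of_objects[OF x(1)] by blast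
      note c = obj_gen_closed[OF AB(1)] obj_gen_closed[OF AB(2)]
      have "h (x - (obj_gen C A - obj_gen C B)) = (\<lambda>i\<in>I. 0)"
        using d \<open>split_relations C \<subseteq> kernel (iso_free_group C) (int_product I) h\<close> by (auto simp: kernel_def)
      then have "(\<lambda>i\<in>I. h x i - (int (mult i A) - int (mult i B))) = (\<lambda>i\<in>I. 0)"
        unfolding h_minus[OF x(1) minus_closed[OF c]] h_minus[OF c] hA[OF AB(1)] hA[OF AB(2)]
        by (simp cong: restrict_cong)
      then have "\<forall>i\<in>I. mult i A = mult i B"
        unfolding x(2) by (metis (no_types, lifting) diff_0
            eq_iff_diff_eq_0 neg_equal_0_iff_equal of_nat_eq_iff restrict_apply')
      then have "obj_gen C A = obj_gen C B"
        using isomorphic_iff_mult[OF AB] obj_gen_isomorphic by blast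
      then show "x \<in> split_relations C" using d by simp
    qed
  qed
  have surj: "h ` carrier (iso_free_group C) = carrier (int_product I)"
  proof
    show "h ` carrier (iso_free_group C) \<subseteq> carrier (int_product I)" using h.hom_closed by blast
    show "carrier (int_product I) \<subseteq> h ` carrier (iso_free_group C)"
    proof
      fix z assume z: "z \<in> carrier (int_product I)"
      obtain A where A: "A \<in> Obj C" "\<forall>i\<in>I. mult i A = nat (z i)"
        using mult_realised[of "\<lambda>i. nat (z i)"] by blast
      obtain B where B: "B \<in> Obj C" "\<forall>i\<in>I. mult i B = nat (- z i)"
        using mult_realised[of "\<lambda>i. nat (- z i)"] by blast
      note c = obj_gen_closed[OF A(1)] obj_gen_closed[OF B(1)]
      have "h (obj_gen C A - obj_gen C B) = (\<lambda>i\<in>I. z i)"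
        unfolding h_minus[OF c] hA[OF A(1)] hA[OF B(1)] using A B by (intro restrict_ext) simp
      also have "\<dots> = z" using z by (intro extensionalityI[of _ I]) (auto simp: PiE_def)
      finally show "z \<in> h ` carrier (iso_free_group C)" using minus_closed[OF c] by blast
    qed
  qed
  define \<Phi> where "\<Phi> = (\<lambda>S. the_elem (h ` S))"
  have "\<Phi> \<in> iso (K0_split C) (int_product I)"
    using h.FactGroup_iso_set[OF surj] unfolding ker K0_split_def \<Phi>_def .
  moreover have "\<Phi> (K0_class C A) = (\<lambda>i\<in>I. int (mult i A))" if A: "A \<in> Obj C" for A
  proof -
    note c = obj_gen_closed[OF A]
    have "h (n + obj_gen C A) = h (obj_gen C A)" if n: "n \<in> split_relations C" for n
    proof -
      have "h n = \<one>\<^bsub>int_product I\<^esub>" using n unfolding ker[symmetric] by (simp add: kernel_def)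
      then have "h (n \<otimes>\<^bsub>iso_free_group C\<^esub> obj_gen C A) = h (obj_gen C A)"
        using h.hom_mult[OF split_relations_carrier[OF n] c] Z.l_one[OF h.hom_closed[OF c]] by simp
      then show ?thesis by simp
    qed
    moreover have "K0_class C A = (\<lambda>n. n + obj_gen C A) ` split_relations C"
      unfolding K0_class_def r_coset_def by auto
    ultimately have "h ` K0_class C A = {h (obj_gen C A)}"
      using subgroup.one_closed[OF split_relations_subgroup] by (auto simp: image_image)
    then show ?thesis unfolding \<Phi>_def using hA[OF A] by simp
  qed
  ultimately show ?thesis using that by blast
qed

end

section \<open>Sums in coordinates\<close>

lemma product_integer_finprod:
  assumes "finite E" "f \<in> E \<rightarrow> carrier (int_product I)" "j \<in> I"
  shows "finprod (int_product I) f E j = (\<Sum>i\<in>E. f i j)"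
proof -
  interpret Z: comm_group "int_product I" by (rule comm_group_product_integer)
  show ?thesis
    using assms(1,2)
  proof (induction E)
    case empty
    then show ?case using assms(3) by simp
  next
    case (insert i E)
    then have "finprod (int_product I) f (insert i E)
        = f i \<otimes>\<^bsub>int_product I\<^esub> finprod (int_product I) f E"
      by (intro Z.finprod_insert) auto
    then show ?case using insert assms(3) by auto
  qed
qed

lemma product_integer_int_pow:
  fixes n :: int
  assumes "x \<in> carrier (int_product I)" "j \<in> I"
  shows "(x [^]\<^bsub>int_product I\<^esub> n) j = n * x j"
proof -
  interpret Z: comm_group "int_product I" by (rule comm_group_product_integer)
  have "(\<lambda>x. x j) \<in> hom (int_product I) integer_group"
    using assms(2) by (auto intro!: homI)
  then interpret p: group_hom "int_product I" integer_group "\<lambda>x. x j"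
    by (intro group_hom.intro group_hom_axioms.intro) auto
  show ?thesis using p.hom_int_pow[OF assms(1), of n] by simp
qed

text \<open>Every finite partial sum that contains the index \<open>j\<close> already has the final \<open>j\<close>-th
  coordinate.\<close>

lemma has_coord_sum_unit_vectors:
  fixes a :: "'i \<Rightarrow> int"
  assumes K: "comm_group K" and \<Phi>: "\<Phi> \<in> iso K (int_product I)"
    and b: "\<And>i. i \<in> I \<Longrightarrow> b i \<in> carrier K" "\<And>i. i \<in> I \<Longrightarrow> \<Phi> (b i) = (\<lambda>j\<in>I. if j = i then 1 else 0)"
  shows "has_coord_sum K \<Phi> I (\<lambda>i. b i [^]\<^bsub>K\<^esub> a i) x \<longleftrightarrow> (\<forall>j\<in>I. \<Phi> x j = a j)"
proof -
  interpret K: comm_group K by (rule K)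
  interpret Z: comm_group "int_product I" by (rule comm_group_product_integer)
  interpret \<Phi>: group_hom K "int_product I" \<Phi>
    using \<Phi> by unfold_locales (simp add: iso_def)
  have coord: "\<Phi> (finprod K (\<lambda>i. b i [^]\<^bsub>K\<^esub> a i) E) j = a j"
    if E: "finite E" "E \<subseteq> I" "j \<in> E" for E j
  proof -
    let ?Z = "int_product I"
    have j: "j \<in> I" using E by blast
    have bE: "(\<lambda>i. b i [^]\<^bsub>K\<^esub> a i) \<in> E \<rightarrow> carrier K" using b(1) E(2) by auto
    have "\<Phi> (finprod K (\<lambda>i. b i [^]\<^bsub>K\<^esub> a i) E) = finprod ?Z (\<lambda>i. \<Phi> (b i [^]\<^bsub>K\<^esub> a i)) E"
      using E(1) bE
    proof (induction E)
      case (insert i E)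
      then have "\<Phi> (finprod K (\<lambda>i. b i [^]\<^bsub>K\<^esub> a i) (insert i E))
          = \<Phi> (b i [^]\<^bsub>K\<^esub> a i) \<otimes>\<^bsub>?Z\<^esub> \<Phi> (finprod K (\<lambda>i. b i [^]\<^bsub>K\<^esub> a i) E)"
        using K.finprod_insert[of E i "\<lambda>i. b i [^]\<^bsub>K\<^esub> a i"]
        by (subst \<Phi>.hom_mult[symmetric]) (auto simp del: mult_product_group)
      also have "\<dots> = finprod ?Z (\<lambda>i. \<Phi> (b i [^]\<^bsub>K\<^esub> a i)) (insert i E)"
        using insert
          by (subst Z.finprod_insert) (auto simp: Pi_iff simp del: mult_product_group carrier_product_group)
      finally show ?case .
    qed simp
    then have "\<Phi> (finprod K (\<lambda>i. b i [^]\<^bsub>K\<^esub> a i) E) j = (\<Sum>i\<in>E. \<Phi> (b i [^]\<^bsub>K\<^esub> a i) j)"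
      using product_integer_finprod[OF E(1) _ j] bE \<Phi>.hom_closed by (simp add: Pi_def)
    also have "\<dots> = (\<Sum>i\<in>E. if i = j then a i else 0)"
    proof (rule sum.cong)
      fix i assume "i \<in> E"
      then have i: "i \<in> I" using E by blast
      have "\<Phi> (b i [^]\<^bsub>K\<^esub> a i) j = a i * \<Phi> (b i) j"
        using \<Phi>.hom_int_pow[OF b(1)[OF i], of "a i"]
          product_integer_int_pow[OF \<Phi>.hom_closed[OF b(1)[OF i]] j]
        by simp
      then show "\<Phi> (b i [^]\<^bsub>K\<^esub> a i) j = (if i = j then a i else 0)" using b(2)[OF i] j by auto
    qed simp
    also have "\<dots> = a j" using E by simp
    finally show ?thesis .
  qed
  show ?thesis
    unfolding has_coord_sum_def eventually_finite_subsets_at_top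
  proof (intro ball_cong refl iffI)
    fix j assume j: "j \<in> I"
    assume "\<exists>E0. finite E0 \<and> E0 \<subseteq> I \<and> (\<forall>E. finite E \<and> E0 \<subseteq> E \<and> E \<subseteq> I \<longrightarrow>
        \<Phi> (finprod K (\<lambda>i. b i [^]\<^bsub>K\<^esub> a i) E) j = \<Phi> x j)"
    then obtain E0 where E0: "finite E0" "E0 \<subseteq> I" and ev: "\<forall>E. finite E \<and> E0 \<subseteq> E \<and> E \<subseteq> I \<longrightarrow>
        \<Phi> (finprod K (\<lambda>i. b i [^]\<^bsub>K\<^esub> a i) E) j = \<Phi> x j" by (elim exE conjE)
    have ins: "finite (insert j E0)" "E0 \<subseteq> insert j E0" "insert j E0 \<subseteq> I" using E0 j by auto
    show "\<Phi> x j = a j" using ev[THEN spec, of "insert j E0"] coord[OF ins(1,3)] ins by simp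
  next
    fix j assume j: "j \<in> I" and x: "\<Phi> x j = a j"
    show "\<exists>E0. finite E0 \<and> E0 \<subseteq> I \<and> (\<forall>E. finite E \<and> E0 \<subseteq> E \<and> E \<subseteq> I \<longrightarrow>
        \<Phi> (finprod K (\<lambda>i. b i [^]\<^bsub>K\<^esub> a i) E) j = \<Phi> x j)"
    proof (intro exI[of _ "{j}"] conjI allI impI)
      fix E assume "finite E \<and> {j} \<subseteq> E \<and> E \<subseteq> I"
      then show "\<Phi> (finprod K (\<lambda>i. b i [^]\<^bsub>K\<^esub> a i) E) j = \<Phi> x j" unfolding x by (intro coord) auto
    qed (use j in auto)
  qed
qed

lemma product_basis_unit_vectors:
  assumes K: "comm_group K" and \<Phi>: "\<Phi> \<in> iso K (int_product I)"
    and b: "\<And>i. i \<in> I \<Longrightarrow> b i \<in> carrier K" "\<And>i. i \<in> I \<Longrightarrow> \<Phi> (b i) = (\<lambda>j\<in>I. if j = i then 1 else 0)"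
  shows "product_basis K \<Phi> I b"
proof -
  note coord = has_coord_sum_unit_vectors[OF K \<Phi> b]
  have bij: "bij_betw \<Phi> (carrier K) (I \<rightarrow>\<^sub>E UNIV)" using \<Phi> by (simp add: iso_def)
  have "\<exists>x\<in>carrier K. \<forall>j\<in>I. \<Phi> x j = a j" if "a \<in> I \<rightarrow>\<^sub>E UNIV" for a
    using bij_betw_imp_surj_on[OF bij] that by (metis imageE)
  moreover have "\<exists>!a. a \<in> I \<rightarrow>\<^sub>E UNIV \<and> (\<forall>j\<in>I. \<Phi> x j = a j)" if x: "x \<in> carrier K" for x
  proof (rule ex1I[of _ "\<Phi> x"])
    show "\<Phi> x \<in> I \<rightarrow>\<^sub>E UNIV \<and> (\<forall>j\<in>I. \<Phi> x j = \<Phi> x j)" using bij_betwE[OF bij] x by simp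
    show "a = \<Phi> x" if "a \<in> I \<rightarrow>\<^sub>E UNIV \<and> (\<forall>j\<in>I. \<Phi> x j = a j)" for a
      using that bij_betwE[OF bij] x by (intro PiE_ext[of a I _ "\<Phi> x"]) auto
  qed
  ultimately show ?thesis unfolding product_basis_def using b(1) by (simp add: coord)
qed

theorem corollary6p9:
  fixes C :: "('o, 'm) precat" and I :: "'i set" and Xs :: "'i \<Rightarrow> 'o"
  assumes "locally_krull_schmidt C"
    and "full_indecomposables C I Xs"
    and "admits_lf_direct_sums C I Xs"
  shows "\<exists>\<Phi>. \<Phi> \<in> iso (K0_split C) (product_group I (\<lambda>_. integer_group))
    \<and> (\<forall>i\<in>I. \<Phi> (K0_class C (Xs i)) = (\<lambda>j\<in>I. if j = i then 1 else 0))
    \<and> product_basis (K0_split C) \<Phi> I (\<lambda>i. K0_class C (Xs i))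
    \<and> (\<forall>M \<in> Obj C.
         \<Phi> (K0_class C M) = (\<lambda>i\<in>I. int (multiplicity_in C (Xs i) M)) \<and>
         has_coord_sum (K0_split C) \<Phi> I
           (\<lambda>i. K0_class C (Xs i) [^]\<^bsub>K0_split C\<^esub> int (multiplicity_in C (Xs i) M))
           (K0_class C M))"
proof -
  interpret locally_krull_schmidt C by fact
  interpret krull_schmidt_basis C I Xs by unfold_locales fact+
  obtain \<Phi> where \<Phi>: "\<Phi> \<in> iso (K0_split C) (product_group I (\<lambda>_. integer_group))"
    and K0_mult: "\<And>A. A \<in> Obj C \<Longrightarrow> \<Phi> (K0_class C A) = (\<lambda>i\<in>I. int (multiplicity_in C (Xs i) A))"
    using K0_iso by blast
  have unit: "\<Phi> (K0_class C (Xs i)) = (\<lambda>j\<in>I. if j = i then 1 else 0)" if "i \<in> I" for i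
    unfolding K0_mult[OF X_obj[OF that]] using mult_X[OF that] by (intro restrict_ext) simp
  note basis = K0_comm_group \<Phi> K0_class_closed[OF X_obj] unit
  have "product_basis (K0_split C) \<Phi> I (\<lambda>i. K0_class C (Xs i))"
    by (rule product_basis_unit_vectors[OF basis])
  moreover have "has_coord_sum (K0_split C) \<Phi> I
      (\<lambda>i. K0_class C (Xs i) [^]\<^bsub>K0_split C\<^esub> int (multiplicity_in C (Xs i) M)) (K0_class C M)"
    if "M \<in> Obj C" for M
    using has_coord_sum_unit_vectors[OF basis] K0_mult[OF that] by simp
  ultimately show ?thesis using \<Phi> unit K0_mult by blast
qed

end
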